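(* Let $C \subset \mathbb{P}^{2}$ be an irreducible and reduced curve in the complex projective plane of degree $d = \deg C \geq 3$ with singular locus $\mathrm{Sing}(C) = \{p_{1}, \ldots, p_{s}\}$ consisting of $s \geq 3$ distinct points, and let $m_{i} = \mathrm{mult}_{p_{i}}(C) \geq 2$ denote the multiplicity of $C$ at $p_{i}$, with the points labelled so that $m_{1} \geq \cdots \geq m_{s}$. Let $o \in \mathrm{Sing}(C)$ and let $m_{o} = \mathrm{mult}_{o}(C)$ be the multiplicity of $C$ at $o$. Then $$C^{2} = d^{2} \geq m_{o} + \sum_{i=1}^{s} (m_{i}-1)^{2} + 2\left(\mathrm{gon}(C) - 1\right).$$
   Context: We work over the complex numbers. The gonality $\mathrm{gon}(C)$ of a complex curve $C$ is the smallest degree of a non-constant map, defined over the complex numbers, from $C$ to the complex projective line $\mathbb{P}^{1}$. $C^2$ denotes the self-intersection number of $C$ in $\mathbb{P}^2$, which equals $d^2$. *)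

theory Defs
  imports
    "HOL-Analysis.Finite_Cartesian_Product"
    "HOL-Analysis.Cartesian_Space"
    "HOL-Computational_Algebra.Computational_Algebra"
    "HOL-Algebra.QuotRing"
    "HOL-Algebra.Generated_Fields"
    "HOL-Algebra.Embedded_Algebras"
    "HOL-Algebra.Algebraic_Closure_Type"
begin

section \<open>Ternary forms and the complex projective plane\<close>

text \<open>
  Polynomials in the homogeneous coordinates $x, y, z$ are elements of $\mathbb{C}[x][y][z]$:
  the outermost variable is $z$ and the innermost one is $x$, so the coefficient of
  $x^i y^j z^k$ in \<open>G\<close> is \<open>coeff (coeff (coeff G k) j) i\<close>.
\<close>

type_synonym poly3 = "complex poly poly poly"

definition eval3 :: "poly3 \<Rightarrow> complex ^ 3 \<Rightarrow> complex" where
  "eval3 G v = poly (poly (poly G [:[:v $ 3:]:]) [:v $ 2:]) (v $ 1)"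

definition partial_x :: "poly3 \<Rightarrow> poly3" where
  "partial_x = map_poly (map_poly pderiv)"

definition partial_y :: "poly3 \<Rightarrow> poly3" where
  "partial_y = map_poly pderiv"

definition partial_z :: "poly3 \<Rightarrow> poly3" where
  "partial_z = pderiv"

definition homogeneous :: "nat \<Rightarrow> poly3 \<Rightarrow> bool" where
  "homogeneous n G \<longleftrightarrow> (\<forall>i j k. coeff (coeff (coeff G k) j) i \<noteq> 0 \<longrightarrow> i + j + k = n)"

definition projective_plane :: "(complex ^ 3) set set" where
  "projective_plane = (UNIV - {0}) // {(v, w). v \<noteq> 0 \<and> w \<noteq> 0 \<and> (\<exists>t. w = t *s v)}"

text \<open>For homogeneous \<open>G\<close> the condition does not depend on the representative \<open>v\<close> of the point.\<close>

definition vanishes_at :: "poly3 \<Rightarrow> (complex ^ 3) set \<Rightarrow> bool" where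
  "vanishes_at G p \<longleftrightarrow> (\<forall>v\<in>p. eval3 G v = 0)"

section \<open>Plane curves\<close>

text \<open>
  A plane curve of degree \<open>d\<close> is given by its equation \<open>F\<close>, a form of degree \<open>d\<close>; it is
  irreducible and reduced iff \<open>F\<close> is an irreducible polynomial. (The qualified name
  distinguishes the type-class notion from the HOL-Algebra one.)
\<close>

definition integral_plane_curve :: "nat \<Rightarrow> poly3 \<Rightarrow> bool" where
  "integral_plane_curve d F \<longleftrightarrow> homogeneous d F \<and> Factorial_Ring.irreducible F"

definition Sing :: "poly3 \<Rightarrow> (complex ^ 3) set set" where
  "Sing F = {p \<in> projective_plane. vanishes_at F p \<and>
     vanishes_at (partial_x F) p \<and> vanishes_at (partial_y F) p \<and> vanishes_at (partial_z F) p}"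

text \<open>
  The multiplicity of the curve at \<open>p\<close> is the order of the Taylor expansion of its equation
  at \<open>p\<close>. It may be taken in all three homogeneous coordinates: along the line through the
  origin that represents \<open>p\<close>, the form \<open>F\<close> only changes by a scalar factor, so the order
  is the same as that of a local equation in an affine chart.
\<close>

definition curve_mult :: "poly3 \<Rightarrow> (complex ^ 3) set \<Rightarrow> nat" where
  "curve_mult F p = (LEAST n. \<exists>i j k. i + j + k = n \<and>
     \<not> vanishes_at ((partial_x ^^ i) ((partial_y ^^ j) ((partial_z ^^ k) F))) p)"

section \<open>Function field and gonality\<close>

text \<open>
  The function field of the integral curve $C = \{F = 0\}$ is the residue field of the local
  ring of the plane at the generic point of $C$: fractions of forms of the same degree whose
  denominator does not vanish identically on $C$, modulo those whose numerator does.
\<close>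

definition curve_local_ring :: "poly3 \<Rightarrow> poly3 fract ring" where
  "curve_local_ring F = ring_of_type_algebra\<lparr>carrier :=
     {Fract G H | G H. \<exists>n. homogeneous n G \<and> homogeneous n H \<and> \<not> F dvd H}\<rparr>"

definition curve_max_ideal :: "poly3 \<Rightarrow> poly3 fract set" where
  "curve_max_ideal F =
     {Fract G H | G H. \<exists>n. homogeneous n G \<and> homogeneous n H \<and> \<not> F dvd H \<and> F dvd G}"

definition function_field :: "poly3 \<Rightarrow> poly3 fract set ring" where
  "function_field F = curve_local_ring F Quot curve_max_ideal F"

definition function_field_constants :: "poly3 \<Rightarrow> poly3 fract set set" where
  "function_field_constants F =
     range (\<lambda>c. curve_max_ideal F +>\<^bsub>curve_local_ring F\<^esub> Fract [:[:[:c:]:]:] 1)"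

text \<open>
  Non-constant rational maps $C \dashrightarrow \mathbb{P}^1$ (equivalently, non-constant
  morphisms to $\mathbb{P}^1$ from the normalization of $C$) are the elements $\varphi$ of
  $\mathbb{C}(C) \setminus \mathbb{C}$, and the degree of such a map is
  $[\mathbb{C}(C) : \mathbb{C}(\varphi)]$. As usual for a possibly singular curve, the
  gonality is taken over these maps.
\<close>

definition map_has_degree :: "poly3 \<Rightarrow> poly3 fract set \<Rightarrow> nat \<Rightarrow> bool" where
  "map_has_degree F \<phi> n \<longleftrightarrow>
     ring.dimension (function_field F) n
       (generate_field (function_field F) (insert \<phi> (function_field_constants F)))
       (carrier (function_field F))"

definition gonality :: "poly3 \<Rightarrow> nat" where
  "gonality F = (LEAST n. \<exists>\<phi> \<in> carrier (function_field F) - function_field_constants F.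
     map_has_degree F \<phi> n)"

end

theory Submission
  imports Defs
begin

text \<open>
  The inequality is the sum of two independent bounds. A polar of the curve, that is, a linear
  combination of the partial derivatives of \<open>F\<close>, has degree $d - 1$ and vanishes to order at
  least $m_i - 1$ at $p_i$. By Euler's identity a common factor of the three partial derivatives
  would divide the irreducible form \<open>F\<close>, which is impossible for degree reasons; hence two
  suitable polars are coprime, and Bezout's inequality for them (\<open>polar_inequality\<close>) says that
  $\sum_i (m_i - 1)^2 \le (d - 1)^2$. On the other hand, the lines through the point \<open>o\<close> meet the
  curve in at most $d - m_o$ further points, so the projection from \<open>o\<close> shows that
  $\mathrm{gon}(C) + m_o \le d$ (\<open>gonality_projection\<close>). Therefore
  \[ m_o + \sum_i (m_i - 1)^2 + 2(\mathrm{gon}(C) - 1) \le 2d - m_o + (d - 1)^2 - 2 = d^2 - 1 - m_o. \]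

  Bezout's inequality with multiplicities (\<open>bezout_inequality\<close>) is proved by counting dimensions.
  If \<open>A\<close> and \<open>B\<close> are coprime forms of degrees $a$ and $b$, then for large $n$ the forms
  $AP + BQ$ of degree $n$ have codimension $ab$ in the space of all forms of degree $n$. On the
  other hand, at a point where \<open>A\<close> and \<open>B\<close> vanish to orders $r$ and $s$, consider the Taylor
  coefficients of order less than $r + s$: the products with \<open>A\<close> only depend on the Taylor
  coefficients of \<open>P\<close> of order less than $s$, and those with \<open>B\<close> on the ones of \<open>Q\<close> of order less
  than $r$, which leaves at least
  ${r+s+1 \choose 2} - {s+1 \choose 2} - {r+1 \choose 2} = rs$ independent conditions.

  All local computations take place in $\mathbb{C}[s,t]$: a form is expanded at a representative of
  the point in the directions of two coordinate axes. The expansion is a ring homomorphism, and a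
  form can be recovered from it by homogenization; the same homomorphism therefore serves to
  describe the function field as generated by two affine coordinates centred at \<open>o\<close>.
\<close>

section \<open>Substitution into ternary forms\<close>

locale unital_hom =
  fixes h :: "'a::comm_ring_1 \<Rightarrow> 'b::comm_ring_1"
  assumes hom_add: "h (a + b) = h a + h b"
    and hom_mult: "h (a * b) = h a * h b"
    and hom_one: "h 1 = 1"
begin

lemma hom_zero: "h 0 = 0"
  using hom_add[of 0 0] by simp

lemma hom_uminus: "h (- a) = - h a"
  using hom_add[of a "- a"] hom_zero by (simp add: add_eq_0_iff)

lemma hom_diff: "h (a - b) = h a - h b"
  using hom_add[of a "- b"] by (simp add: hom_uminus)

lemma hom_sum: "h (sum f A) = (\<Sum>a\<in>A. h (f a))"
  by (induction A rule: infinite_finite_induct) (auto simp: hom_zero hom_add)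

lemma hom_power: "h (a ^ n) = h a ^ n"
  by (induction n) (auto simp: hom_one hom_mult)

lemma poly_map_poly_pCons:
  "poly (map_poly h (pCons c p)) x = h c + x * poly (map_poly h p) x"
  by (simp add: map_poly_pCons hom_zero)

lemma unital_hom_poly_map_poly: "unital_hom (\<lambda>p. poly (map_poly h p) x)"
proof
  have add: "map_poly h (p + q) = map_poly h p + map_poly h q" for p q
    by (rule poly_eqI) (simp add: coeff_map_poly hom_zero hom_add)
  show "poly (map_poly h (p + q)) x = poly (map_poly h p) x + poly (map_poly h q) x" for p q
    by (simp add: add)
  have smult: "map_poly h (smult c q) = smult (h c) (map_poly h q)" for c q
    by (rule poly_eqI) (simp add: coeff_map_poly hom_zero hom_mult)
  show "poly (map_poly h (p * q)) x = poly (map_poly h p) x * poly (map_poly h q) x" for p q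
    by (induction p) (simp_all add: poly_map_poly_pCons add smult algebra_simps hom_zero)
  show "poly (map_poly h 1) x = 1"
    using poly_map_poly_pCons[of 1 0 x] by (simp add: hom_one)
qed

end

text \<open>
  Both sides are additive in \<open>p\<close> and satisfy the same Leibniz rule for multiplication by the
  variable; this is the chain rule for one variable, with \<open>D\<close> also acting on the coefficients.
\<close>
lemma poly_map_poly_derivation:
  fixes h :: "'a::idom \<Rightarrow> 'b::comm_ring_1"
  assumes h: "unital_hom h"
    and add: "\<And>a b. D (a + b) = D a + D b"
    and mult: "\<And>a b. D (a * b) = D a * b + a * D b"
  shows "D (poly (map_poly h p) x) =
    poly (map_poly (\<lambda>a. D (h a)) p) x + poly (map_poly h (pderiv p)) x * D x"
proof -
  interpret unital_hom h by fact
  interpret E: unital_hom "\<lambda>p. poly (map_poly h p) x"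
    by (rule unital_hom_poly_map_poly)
  have D0: "D 0 = 0"
    using add[of 0 0] by simp
  show ?thesis
  proof (induction p)
    case (pCons c p)
    then show ?case
      by (simp add: poly_map_poly_pCons map_poly_pCons hom_zero D0 add mult pderiv_pCons E.hom_add
          algebra_simps)
  qed (simp add: D0)
qed

lemma unital_hom_comp: "unital_hom f \<Longrightarrow> unital_hom g \<Longrightarrow> unital_hom (\<lambda>x. f (g x))"
  by (simp add: unital_hom_def)

lemma hom_poly_map_poly:
  assumes "unital_hom f" "unital_hom g"
  shows "f (poly (map_poly g p) x) = poly (map_poly (\<lambda>a. f (g a)) p) (f x)"
proof -
  interpret f: unital_hom f by fact
  interpret g: unital_hom g by fact
  show ?thesis
    by (induction p) (simp_all add: f.hom_zero g.hom_zero f.hom_add f.hom_mult map_poly_pCons)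
qed

definition subst2 :: "(complex \<Rightarrow> 'a::comm_ring_1) \<Rightarrow> complex poly poly \<Rightarrow> 'a \<Rightarrow> 'a \<Rightarrow> 'a" where
  "subst2 \<kappa> f a b = poly (map_poly (\<lambda>e. poly (map_poly \<kappa> e) a) f) b"

definition subst3 :: "(complex \<Rightarrow> 'a::comm_ring_1) \<Rightarrow> poly3 \<Rightarrow> 'a \<Rightarrow> 'a \<Rightarrow> 'a \<Rightarrow> 'a" where
  "subst3 \<kappa> G x y z = poly (map_poly (\<lambda>f. subst2 \<kappa> f x y) G) z"

lemma unital_hom_subst2: "unital_hom \<kappa> \<Longrightarrow> unital_hom (\<lambda>f. subst2 \<kappa> f a b)"
  unfolding subst2_def by (intro unital_hom.unital_hom_poly_map_poly)

lemma unital_hom_subst3: "unital_hom \<kappa> \<Longrightarrow> unital_hom (\<lambda>G. subst3 \<kappa> G x y z)"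
  unfolding subst3_def by (intro unital_hom.unital_hom_poly_map_poly unital_hom_subst2)

lemma hom_subst2:
  assumes "unital_hom f" "unital_hom \<kappa>"
  shows "f (subst2 \<kappa> g a b) = subst2 (\<lambda>c. f (\<kappa> c)) g (f a) (f b)"
  unfolding subst2_def
  by (subst hom_poly_map_poly[OF assms(1)])
    (auto intro!: unital_hom.unital_hom_poly_map_poly assms simp: hom_poly_map_poly[OF assms])

lemma hom_subst3:
  assumes "unital_hom f" "unital_hom \<kappa>"
  shows "f (subst3 \<kappa> G x y z) = subst3 (\<lambda>c. f (\<kappa> c)) G (f x) (f y) (f z)"
  unfolding subst3_def
  by (subst hom_poly_map_poly[OF assms(1)])
    (auto intro!: unital_hom_subst2 assms simp: hom_subst2[OF assms])

abbreviation const3 :: "complex \<Rightarrow> poly3" where "const3 c \<equiv> [:[:[:c:]:]:]"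
abbreviation X3 :: poly3 where "X3 \<equiv> [:[:[:0, 1:]:]:]"
abbreviation Y3 :: poly3 where "Y3 \<equiv> [:[:0, 1:]:]"
abbreviation Z3 :: poly3 where "Z3 \<equiv> [:0, 1:]"
abbreviation const2 :: "complex \<Rightarrow> complex poly poly" where "const2 c \<equiv> [:[:c:]:]"
abbreviation S2 :: "complex poly poly" where "S2 \<equiv> [:[:0, 1:]:]"
abbreviation T2 :: "complex poly poly" where "T2 \<equiv> [:0, 1:]"

lemma unital_hom_const2: "unital_hom const2"
  by standard (simp_all add: one_pCons)

lemma unital_hom_const3: "unital_hom const3"
  by standard (simp_all add: one_pCons)

lemma subst2_const2: "unital_hom \<kappa> \<Longrightarrow> subst2 \<kappa> (const2 c) a b = \<kappa> c"
  and subst2_S2: "unital_hom \<kappa> \<Longrightarrow> subst2 \<kappa> S2 a b = a"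
  and subst2_T2: "unital_hom \<kappa> \<Longrightarrow> subst2 \<kappa> T2 a b = b"
  by (simp_all add: subst2_def map_poly_pCons unital_hom.hom_zero unital_hom.hom_one map_poly_1'
      one_pCons)

lemma subst3_const3: "unital_hom \<kappa> \<Longrightarrow> subst3 \<kappa> (const3 c) x y z = \<kappa> c"
  and subst3_X3: "unital_hom \<kappa> \<Longrightarrow> subst3 \<kappa> X3 x y z = x"
  and subst3_Y3: "unital_hom \<kappa> \<Longrightarrow> subst3 \<kappa> Y3 x y z = y"
  and subst3_Z3: "unital_hom \<kappa> \<Longrightarrow> subst3 \<kappa> Z3 x y z = z"
  by (simp_all add: subst3_def subst2_def map_poly_pCons unital_hom.hom_zero unital_hom.hom_one
      one_pCons)

lemma poly_map_poly_distrib: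
  fixes g h :: "'a::comm_ring_1 \<Rightarrow> 'b::comm_ring_1"
  assumes "g 0 = 0" "h 0 = 0"
  shows "poly (map_poly (\<lambda>a. g a * u + h a * v) p) t =
    poly (map_poly g p) t * u + poly (map_poly h p) t * v"
  by (induction p) (simp_all add: map_poly_pCons assms algebra_simps)

text \<open>
  The chain rule. It is stated for an arbitrary derivation of the target ring so that it covers
  both partial derivatives of $\mathbb{C}[s,t]$.
\<close>
lemma subst3_derivation:
  assumes \<kappa>: "unital_hom \<kappa>"
    and add: "\<And>a b. D (a + b) = D a + D b"
    and mult: "\<And>a b. D (a * b) = D a * b + a * D b"
    and const: "\<And>c. D (\<kappa> c) = 0"
  shows "D (subst3 \<kappa> G x y z) = subst3 \<kappa> (partial_x G) x y z * D x
    + subst3 \<kappa> (partial_y G) x y z * D y + subst3 \<kappa> (partial_z G) x y z * D z"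
proof -
  interpret \<kappa>: unital_hom \<kappa> by fact
  interpret E1: unital_hom "\<lambda>e. poly (map_poly \<kappa> e) x"
    by (rule \<kappa>.unital_hom_poly_map_poly)
  interpret E2: unital_hom "\<lambda>f. subst2 \<kappa> f x y"
    by (rule unital_hom_subst2[OF \<kappa>])
  have zero: "poly (map_poly (\<lambda>_. 0 :: 'a) e) t = 0" for e :: "complex poly" and t
    by (induction e) (simp_all add: map_poly_pCons)
  have d1: "D (poly (map_poly \<kappa> e) x) = poly (map_poly \<kappa> (pderiv e)) x * D x" for e
    using poly_map_poly_derivation[OF \<kappa>, of D e x, OF add mult]
    by (simp add: const zero)
  have d2: "D (subst2 \<kappa> f x y) =
      subst2 \<kappa> (map_poly pderiv f) x y * D x + subst2 \<kappa> (pderiv f) x y * D y" for f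
    using poly_map_poly_derivation[OF E1.unital_hom_axioms, of D f y, OF add mult]
      poly_map_poly_distrib[of "\<lambda>e. poly (map_poly \<kappa> (pderiv e)) x" "\<lambda>_. 0" "D x" 0 f y]
    by (simp add: d1 subst2_def map_poly_map_poly E1.hom_zero o_def)
  show ?thesis
    using poly_map_poly_derivation[OF E2.unital_hom_axioms, of D G z, OF add mult]
      poly_map_poly_distrib[of "\<lambda>f. subst2 \<kappa> (map_poly pderiv f) x y"
        "\<lambda>f. subst2 \<kappa> (pderiv f) x y" "D x" "D y" G z]
    by (simp add: d2 subst3_def map_poly_map_poly E2.hom_zero o_def
        partial_x_def partial_y_def partial_z_def)
qed

section \<open>Coefficients and homogeneity\<close>

abbreviation coef2 :: "complex poly poly \<Rightarrow> nat \<Rightarrow> nat \<Rightarrow> complex" where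
  "coef2 f i j \<equiv> coeff (coeff f j) i"

abbreviation coef3 :: "poly3 \<Rightarrow> nat \<Rightarrow> nat \<Rightarrow> nat \<Rightarrow> complex" where
  "coef3 G i j k \<equiv> coeff (coeff (coeff G k) j) i"

lemma poly3_eqI: "(\<And>i j k. coef3 G i j k = coef3 H i j k) \<Longrightarrow> G = H"
  by (intro poly_eqI) auto

lemma coeff_of_nat_times: "coeff (of_nat n * f) j = of_nat n * coeff f j"
  by (simp add: of_nat_poly)

lemma coef3_partial_x: "coef3 (partial_x G) i j k = of_nat (Suc i) * coef3 G (Suc i) j k"
  and coef3_partial_y: "coef3 (partial_y G) i j k = of_nat (Suc j) * coef3 G i (Suc j) k"
  and coef3_partial_z: "coef3 (partial_z G) i j k = of_nat (Suc k) * coef3 G i j (Suc k)"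
  by (simp_all add: partial_x_def partial_y_def partial_z_def coeff_map_poly coeff_pderiv
      coeff_of_nat_times del: of_nat_Suc)


definition mono3 :: "nat \<times> nat \<times> nat \<Rightarrow> poly3" where
  "mono3 = (\<lambda>(i, j, k). monom (monom (monom 1 i) j) k)"

definition exponents :: "nat \<Rightarrow> (nat \<times> nat \<times> nat) set" where
  "exponents n = {(i, j, k). i + j + k = n}"

definition triangle :: "nat \<Rightarrow> (nat \<times> nat) set" where
  "triangle r = {(i, j). i + j < r}"

lemma triangle_Suc: "triangle (Suc r) = triangle r \<union> (\<lambda>i. (i, r - i)) ` {..r}"
  by (auto simp: triangle_def image_iff)

lemma finite_triangle: "finite (triangle r)"
  by (induction r) (auto simp: triangle_Suc, simp add: triangle_def)

lemma card_triangle: "2 * card (triangle r) = r * (r + 1)"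
proof (induction r)
  case (Suc r)
  have "card (triangle (Suc r)) = card (triangle r) + card ((\<lambda>i. (i, r - i)) ` {..r})"
    unfolding triangle_Suc
    by (rule card_Un_disjoint) (auto simp: finite_triangle, auto simp: triangle_def)
  also have "card ((\<lambda>i. (i, r - i)) ` {..r}) = r + 1"
    by (subst card_image) (auto simp: inj_on_def)
  finally show ?case
    using Suc by simp
qed (simp add: triangle_def)

lemma exponents_eq_image: "exponents n = (\<lambda>(i, j). (i, j, n - i - j)) ` triangle (Suc n)"
  by (auto simp: exponents_def triangle_def image_iff)

lemma finite_exponents: "finite (exponents n)"
  by (simp add: exponents_eq_image finite_triangle)

lemma card_exponents: "2 * card (exponents n) = (n + 1) * (n + 2)"
proof -
  have "card (exponents n) = card (triangle (Suc n))"
    unfolding exponents_eq_image by (rule card_image) (auto simp: inj_on_def)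
  then show ?thesis
    using card_triangle[of "Suc n"] by simp
qed

lemma coef3_mono3: "coef3 (mono3 (a, b, c)) i j k = (if (i, j, k) = (a, b, c) then 1 else 0)"
  by (auto simp: mono3_def)

lemma mono3_mult: "mono3 (a, b, c) * mono3 (a', b', c') = mono3 (a + a', b + b', c + c')"
  by (simp add: mono3_def mult_monom)

lemma mono3_eq: "mono3 (i, j, k) = X3 ^ i * Y3 ^ j * Z3 ^ k"
proof -
  have "X3 ^ i = mono3 (i, 0, 0)"
    by (induction i) (simp_all add: mono3_def monom_Suc one_pCons monom_0)
  moreover have "Y3 ^ j = mono3 (0, j, 0)"
    by (induction j) (simp_all add: mono3_def monom_Suc one_pCons monom_0 flip: one_pCons)
  moreover have "Z3 ^ k = mono3 (0, 0, k)"
    by (induction k) (simp_all add: mono3_def monom_Suc one_pCons monom_0 flip: one_pCons)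
  ultimately show ?thesis
    by (simp add: mono3_mult)
qed

lemma coef3_mult:
  "coef3 (A * B) i j k = (\<Sum>c\<le>k. \<Sum>b\<le>j. \<Sum>a\<le>i. coef3 A a b c * coef3 B (i - a) (j - b) (k - c))"
  by (simp add: coeff_mult coeff_sum)

lemma coef2_mult:
  "coef2 (f * g) i j = (\<Sum>b\<le>j. \<Sum>a\<le>i. coef2 f a b * coef2 g (i - a) (j - b))"
  by (simp add: coeff_mult coeff_sum)

lemma homogeneous_mult:
  assumes "homogeneous a A" "homogeneous b B"
  shows "homogeneous (a + b) (A * B)"
  unfolding homogeneous_def
proof (intro allI impI)
  fix i j k
  assume "coef3 (A * B) i j k \<noteq> 0"
  then obtain c b' a' where "c \<le> k" "b' \<le> j" "a' \<le> i"
    and *: "coef3 A a' b' c * coef3 B (i - a') (j - b') (k - c) \<noteq> 0"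
    unfolding coef3_mult by (metis (no_types, lifting) atMost_iff sum.neutral)
  moreover have "a' + b' + c = a" "(i - a') + (j - b') + (k - c) = b"
    using assms * by (auto simp: homogeneous_def)
  ultimately show "i + j + k = a + b" by simp
qed

lemma homogeneous_add: "homogeneous n A \<Longrightarrow> homogeneous n B \<Longrightarrow> homogeneous n (A + B)"
  by (force simp: homogeneous_def)

lemma homogeneous_0: "homogeneous n 0"
  by (simp add: homogeneous_def)

lemma homogeneous_sum: "(\<And>x. x \<in> I \<Longrightarrow> homogeneous n (f x)) \<Longrightarrow> homogeneous n (sum f I)"
  by (induction I rule: infinite_finite_induct) (auto simp: homogeneous_0 homogeneous_add)

lemma homogeneous_const3: "homogeneous 0 (const3 c)"
  by (auto simp: homogeneous_def coeff_pCons split: nat.splits)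

lemma homogeneous_const3_mult: "homogeneous n A \<Longrightarrow> homogeneous n (const3 c * A)"
  by (simp add: homogeneous_def)

lemma homogeneous_diff: "homogeneous n A \<Longrightarrow> homogeneous n B \<Longrightarrow> homogeneous n (A - B)"
  by (force simp: homogeneous_def)

lemma homogeneous_power: "homogeneous a A \<Longrightarrow> homogeneous (a * n) (A ^ n)"
proof (induction n)
  case 0
  then show ?case using homogeneous_const3[of 1] by (simp add: one_pCons)
next
  case (Suc n)
  then show ?case using homogeneous_mult[of a A "a * n" "A ^ n"] by simp
qed

lemma homogeneous_prod:
  "(\<And>x. x \<in> I \<Longrightarrow> homogeneous n (f x)) \<Longrightarrow> homogeneous (card I * n) (prod f I)"
proof (induction I rule: infinite_finite_induct)
  case (insert x I)
  then show ?case using homogeneous_mult[of n "f x" "card I * n" "prod f I"] by simp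
qed (use homogeneous_const3[of 1] in \<open>auto simp: one_pCons\<close>)

lemma homogeneous_X3: "homogeneous 1 X3"
  and homogeneous_Y3: "homogeneous 1 Y3"
  and homogeneous_Z3: "homogeneous 1 Z3"
  by (auto simp: homogeneous_def coeff_pCons split: nat.splits)

lemma homogeneous_mono3: "\<mu> \<in> exponents n \<Longrightarrow> homogeneous n (mono3 \<mu>)"
  by (cases \<mu>) (simp add: homogeneous_def exponents_def coef3_mono3)

lemma homogeneous_partial:
  assumes "homogeneous (Suc n) G"
  shows "homogeneous n (partial_x G)" "homogeneous n (partial_y G)" "homogeneous n (partial_z G)"
  using assms unfolding homogeneous_def
  by (force simp: coef3_partial_x coef3_partial_y coef3_partial_z)+

lemma homogeneous_expand:
  assumes "homogeneous n G"
  shows "G = (\<Sum>(i, j, k)\<in>exponents n. const3 (coef3 G i j k) * mono3 (i, j, k))"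
proof (rule poly3_eqI)
  fix i j k
  have "coef3 (\<Sum>(i, j, k)\<in>exponents n. const3 (coef3 G i j k) * mono3 (i, j, k)) i j k =
      (\<Sum>\<mu>\<in>exponents n. if \<mu> = (i, j, k) then coef3 G i j k else 0)"
    unfolding coeff_sum by (rule sum.cong) (auto simp: coef3_mono3 split: if_splits)
  also have "\<dots> = coef3 G i j k"
  proof (cases "(i, j, k) \<in> exponents n")
    case True
    then show ?thesis by (simp add: finite_exponents sum.delta)
  next
    case False
    then have "coef3 G i j k = 0"
      using assms by (auto simp: exponents_def homogeneous_def)
    then show ?thesis by (auto intro!: sum.neutral)
  qed
  finally show "coef3 G i j k =
      coef3 (\<Sum>(i, j, k)\<in>exponents n. const3 (coef3 G i j k) * mono3 (i, j, k)) i j k" ..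
qed

lemma homogeneous_0_imp_const3: "homogeneous 0 G \<Longrightarrow> \<exists>c. G = const3 c"
  by (drule homogeneous_expand) (auto simp: exponents_def mono3_eq)

lemma subst3_homogeneous:
  assumes "unital_hom \<kappa>" "homogeneous n G"
  shows "subst3 \<kappa> G x y z =
    (\<Sum>(i, j, k)\<in>exponents n. \<kappa> (coef3 G i j k) * (x ^ i * y ^ j * z ^ k))"
proof -
  interpret E: unital_hom "\<lambda>G. subst3 \<kappa> G x y z"
    by (rule unital_hom_subst3[OF assms(1)])
  show ?thesis
    by (subst homogeneous_expand[OF assms(2)])
      (auto intro!: sum.cong simp del: mult_pCons_left simp: E.hom_sum E.hom_mult E.hom_power mono3_eq
        subst3_const3[OF assms(1)] subst3_X3[OF assms(1)] subst3_Y3[OF assms(1)] subst3_Z3[OF assms(1)])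
qed

lemma subst3_scale:
  assumes "unital_hom \<kappa>" "homogeneous n G"
  shows "subst3 \<kappa> G (c * x) (c * y) (c * z) = c ^ n * subst3 \<kappa> G x y z"
proof -
  have "(c * x) ^ i * (c * y) ^ j * (c * z) ^ k = c ^ (i + j + k) * (x ^ i * y ^ j * z ^ k)" for i j k
    by (simp add: power_mult_distrib power_add mult_ac)
  then show ?thesis
    unfolding subst3_homogeneous[OF assms] sum_distrib_left
    by (intro sum.cong) (auto simp: exponents_def mult_ac)
qed

lemma subst3_identity: "subst3 const3 G X3 Y3 Z3 = G"
proof -
  have 1: "poly (map_poly const3 e) X3 = [:[:e:]:]" for e
    by (induction e) (simp_all add: map_poly_pCons)
  have 2: "subst2 const3 f X3 Y3 = [:f:]" for f
    unfolding subst2_def by (induction f) (simp_all add: map_poly_pCons 1)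
  show ?thesis
    unfolding subst3_def by (induction G) (simp_all add: map_poly_pCons 2)
qed

section \<open>Taylor expansion of a form at a point\<close>

text \<open>
  The expansion of \<open>G\<close> at the vector \<open>v\<close> in $\mathbb{C}[s,t]$, where \<open>s\<close> is the inner and \<open>t\<close> the
  outer variable. A coordinate that is nonzero at \<open>v\<close> is kept fixed, and the other two move: in this
  way the line spanned by \<open>v\<close> is transversal to the plane in which the expansion is taken, and no
  change of coordinates is needed.
\<close>
definition local_exp :: "complex ^ 3 \<Rightarrow> poly3 \<Rightarrow> complex poly poly" where
  "local_exp v G =
    (if v $ 3 \<noteq> 0 then subst3 const2 G [:[:v $ 1, 1:]:] [:[:v $ 2:], 1:] [:[:v $ 3:]:]
     else if v $ 2 \<noteq> 0 then subst3 const2 G [:[:v $ 1, 1:]:] [:[:v $ 2:]:] [:[:v $ 3:], 1:]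
     else subst3 const2 G [:[:v $ 1:]:] [:[:v $ 2, 1:]:] [:[:v $ 3:], 1:])"

lemma unital_hom_local_exp: "unital_hom (local_exp v)"
proof -
  have "\<exists>x y z. local_exp v = (\<lambda>G. subst3 const2 G x y z)"
    unfolding local_exp_def by (cases "v $ 3 \<noteq> 0"; cases "v $ 2 \<noteq> 0") (simp_all, blast+)
  then show ?thesis
    using unital_hom_subst3[OF unital_hom_const2] by metis
qed

interpretation local_exp: unital_hom "local_exp v" for v
  by (rule unital_hom_local_exp)

lemma local_exp_const3: "local_exp v (const3 c) = const2 c"
  by (simp add: local_exp_def subst3_const3[OF unital_hom_const2])

lemma local_exp_coords:
  "local_exp v X3 = (if v $ 3 = 0 \<and> v $ 2 = 0 then [:[:v $ 1:]:] else [:[:v $ 1, 1:]:])"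
  "local_exp v Y3 = (if v $ 3 \<noteq> 0 then [:[:v $ 2:], 1:] else if v $ 2 \<noteq> 0 then [:[:v $ 2:]:]
     else [:[:v $ 2, 1:]:])"
  "local_exp v Z3 = (if v $ 3 \<noteq> 0 then [:[:v $ 3:]:] else [:[:v $ 3:], 1:])"
  by (simp_all add: local_exp_def subst3_X3[OF unital_hom_const2] subst3_Y3[OF unital_hom_const2]
      subst3_Z3[OF unital_hom_const2])

lemma local_exp_eq_subst3:
  "local_exp v G = subst3 const2 G (local_exp v X3) (local_exp v Y3) (local_exp v Z3)"
  unfolding local_exp_coords by (simp add: local_exp_def)

text \<open>
  Linear forms whose expansions are the two local coordinates and the constant \<open>1\<close>. They form a basis
  of the linear forms, so they invert the expansion on forms of a given degree.
\<close>
lemma local_frame: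
  fixes v :: "complex ^ 3"
  assumes "v \<noteq> 0"
  obtains U V W where "homogeneous 1 U" "homogeneous 1 V" "homogeneous 1 W"
    "local_exp v U = S2" "local_exp v V = T2" "local_exp v W = 1"
    "\<And>H. H \<in> {X3, Y3, Z3} \<Longrightarrow> \<exists>c a b. H = const3 c * W + const3 a * U + const3 b * V"
proof -
  note frame = that
  have *: thesis
    if P: "local_exp v P = const2 c" "c \<noteq> 0"
      and Q: "local_exp v Q = const2 a + S2" and R: "local_exp v R = const2 b + T2"
      and PQR: "{P, Q, R} = {X3, Y3, Z3}"
    for P Q R a b c
  proof (rule frame)
    have hom: "homogeneous 1 H" if "H \<in> {P, Q, R}" for H
      using that PQR homogeneous_X3 homogeneous_Y3 homogeneous_Z3 by auto
    let ?W = "const3 (1 / c) * P" and ?U = "Q - const3 (a / c) * P" and ?V = "R - const3 (b / c) * P"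
    show "homogeneous 1 ?U" "homogeneous 1 ?V" "homogeneous 1 ?W"
      using hom by (auto simp only: insert_iff intro!: homogeneous_diff homogeneous_const3_mult)
    show "local_exp v ?U = S2" "local_exp v ?V = T2" "local_exp v ?W = 1"
      using P(2) by (simp_all only: local_exp.hom_diff local_exp.hom_mult local_exp_const3 P(1) Q R)
        (simp_all add: one_pCons)
    have WP: "P = const3 c * ?W"
      using P(2) by (simp flip: one_pCons)
    fix H
    assume "H \<in> {X3, Y3, Z3}"
    then have "H \<in> {P, Q, R}"
      by (simp only: PQR)
    moreover have "P = const3 c * ?W + const3 0 * ?U + const3 0 * ?V"
      using WP by simp
    moreover have "Q = const3 a * ?W + const3 1 * ?U + const3 0 * ?V"
      by (simp flip: one_pCons)
    moreover have "R = const3 b * ?W + const3 0 * ?U + const3 1 * ?V"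
      by (simp flip: one_pCons)
    ultimately show "\<exists>c a b. H = const3 c * ?W + const3 a * ?U + const3 b * ?V"
      by blast
  qed
  consider "v $ 3 \<noteq> 0" | "v $ 3 = 0" "v $ 2 \<noteq> 0" | "v $ 3 = 0" "v $ 2 = 0" "v $ 1 \<noteq> 0"
    using assms by (metis (mono_tags, lifting) exhaust_3 vec_eq_iff zero_index)
  then show thesis
  proof cases
    case 1
    show thesis
      by (rule *[of Z3 "v $ 3" X3 "v $ 1" Y3 "v $ 2"]) (use 1 in \<open>auto simp: local_exp_coords\<close>)
  next
    case 2
    show thesis
      by (rule *[of Y3 "v $ 2" X3 "v $ 1" Z3 "v $ 3"]) (use 2 in \<open>auto simp: local_exp_coords\<close>)
  next
    case 3
    show thesis
      by (rule *[of X3 "v $ 1" Y3 "v $ 2" Z3 "v $ 3"]) (use 3 in \<open>auto simp: local_exp_coords\<close>)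
  qed
qed

text \<open>
  Both coordinates of the chart move along coordinate axes, so the derivatives of the expansion
  are expansions of partial derivatives.
\<close>

lemma local_exp_derivatives:
  "\<exists>D\<in>{partial_x, partial_y, partial_z}. \<exists>D'\<in>{partial_x, partial_y, partial_z}.
    (\<forall>G. map_poly pderiv (local_exp v G) = local_exp v (D G)) \<and>
    (\<forall>G. pderiv (local_exp v G) = local_exp v (D' G))" (is "?P")
proof -
  have add: "map_poly pderiv (f + g) = map_poly pderiv f + map_poly pderiv g"
    for f g :: "complex poly poly"
    by (rule poly_eqI) (simp add: coeff_map_poly pderiv_add)
  have smult: "map_poly pderiv (smult c g) = smult (pderiv c) g + smult c (map_poly pderiv g)"
    for c and g :: "complex poly poly"
    by (rule poly_eqI) (simp add: coeff_map_poly pderiv_mult)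
  have mult: "map_poly pderiv (f * g) = map_poly pderiv f * g + f * map_poly pderiv g"
    for f g :: "complex poly poly"
    by (induction f) (simp_all add: map_poly_pCons add smult algebra_simps)
  have s: "map_poly pderiv (local_exp v G) =
      local_exp v (partial_x G) * map_poly pderiv (local_exp v X3)
      + local_exp v (partial_y G) * map_poly pderiv (local_exp v Y3)
      + local_exp v (partial_z G) * map_poly pderiv (local_exp v Z3)" for G
    unfolding local_exp_eq_subst3[of v G] local_exp_eq_subst3[of v "partial_x G"]
      local_exp_eq_subst3[of v "partial_y G"] local_exp_eq_subst3[of v "partial_z G"]
    by (rule subst3_derivation[OF unital_hom_const2 add mult])
      (simp add: map_poly_pCons)
  have t: "pderiv (local_exp v G) =
      local_exp v (partial_x G) * pderiv (local_exp v X3)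
      + local_exp v (partial_y G) * pderiv (local_exp v Y3)
      + local_exp v (partial_z G) * pderiv (local_exp v Z3)" for G
    unfolding local_exp_eq_subst3[of v G] local_exp_eq_subst3[of v "partial_x G"]
      local_exp_eq_subst3[of v "partial_y G"] local_exp_eq_subst3[of v "partial_z G"]
    by (rule subst3_derivation[OF unital_hom_const2 pderiv_add])
      (simp_all add: pderiv_mult pderiv_pCons mult.commute add.commute)
  have d: "map_poly pderiv [:[:a, 1:]:] = 1" "map_poly pderiv [:[:a:]:] = 0"
    "map_poly pderiv [:[:a:], 1:] = 0" "pderiv [:[:a, 1:]:] = 0" "pderiv [:[:a:]:] = 0"
    "pderiv [:[:a:], 1:] = 1" "map_poly pderiv [:0, 1 :: complex poly:] = 0"
    "pderiv [:0, 1 :: complex poly:] = 1" for a :: complex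
    by (simp_all add: map_poly_pCons pderiv_pCons map_poly_1 flip: one_pCons)
  have intro: ?P if "D \<in> {partial_x, partial_y, partial_z}" "D' \<in> {partial_x, partial_y, partial_z}"
    "\<And>G. map_poly pderiv (local_exp v G) = local_exp v (D G)"
    "\<And>G. pderiv (local_exp v G) = local_exp v (D' G)" for D D'
    using that by blast
  consider "v $ 3 \<noteq> 0" | "v $ 3 = 0" "v $ 2 \<noteq> 0" | "v $ 3 = 0" "v $ 2 = 0"
    by blast
  then show ?P
  proof cases
    case 1
    show ?P
      by (rule intro[of partial_x partial_y], simp, simp, subst s, simp add: 1 local_exp_coords d,
          subst t, simp add: 1 local_exp_coords d)
  next
    case 2
    show ?P
      by (rule intro[of partial_x partial_z], simp, simp, subst s, simp add: 2 local_exp_coords d,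
          subst t, simp add: 2 local_exp_coords d)
  next
    case 3
    show ?P
      by (rule intro[of partial_y partial_z], simp, simp, subst s, simp add: 3 local_exp_coords d,
          subst t, simp add: 3 local_exp_coords d)
  qed
qed

lemma local_exp_at_point: "coef2 (local_exp v G) 0 0 = eval3 G v"
proof -
  interpret id: unital_hom "\<lambda>c::complex. c" by standard auto
  interpret ev: unital_hom "\<lambda>f. subst2 (\<lambda>c::complex. c) f 0 0"
    by (rule unital_hom_subst2) unfold_locales
  have ev: "subst2 (\<lambda>c. c) f 0 0 = coef2 f 0 0" for f
    by (simp add: subst2_def map_poly_idI poly_0_coeff_0 coeff_map_poly)
  have "coef2 (local_exp v G) 0 0 = subst3 (\<lambda>c. c) G (v $ 1) (v $ 2) (v $ 3)"
    unfolding local_exp_eq_subst3[of v G] ev[symmetric]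
    by (subst hom_subst3[OF ev.unital_hom_axioms unital_hom_const2])
      (simp_all add: ev local_exp_coords)
  also have "\<dots> = eval3 G v"
  proof -
    have 2: "poly f (v $ 1) = subst2 (\<lambda>c. c) [:f:] (v $ 1) b" for f b
      by (simp add: subst2_def map_poly_pCons map_poly_idI)
    have 1: "poly (poly f [:v $ 2:]) (v $ 1) = subst2 (\<lambda>c. c) f (v $ 1) (v $ 2)" for f
      unfolding subst2_def by (induction f) (simp_all add: map_poly_pCons map_poly_idI)
    have "poly (poly (poly G [:[:v $ 3:]:]) [:v $ 2:]) (v $ 1) =
        subst3 (\<lambda>c. c) G (v $ 1) (v $ 2) (v $ 3)"
    proof -
      interpret u: unital_hom "\<lambda>f. subst2 (\<lambda>c::complex. c) f (v $ 1) (v $ 2)"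
        by (rule unital_hom_subst2) unfold_locales
      show ?thesis
        unfolding subst3_def
        by (induction G) (simp_all add: map_poly_pCons u.hom_zero 1[symmetric])
    qed
    then show ?thesis by (simp add: eval3_def)
  qed
  finally show ?thesis .
qed

section \<open>Order of vanishing\<close>

definition order_ge :: "nat \<Rightarrow> complex poly poly \<Rightarrow> bool" where
  "order_ge r f \<longleftrightarrow> (\<forall>i j. i + j < r \<longrightarrow> coef2 f i j = 0)"

lemma order_ge_mult:
  assumes "order_ge r f" "order_ge s g"
  shows "order_ge (r + s) (f * g)"
  unfolding order_ge_def coef2_mult
proof (intro allI impI sum.neutral ballI)
  fix i j b a
  assume *: "i + j < r + s" "b \<in> {..j}" "a \<in> {..i}"
  then have "a + b < r \<or> (i - a) + (j - b) < s" by auto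
  then show "coef2 f a b * coef2 g (i - a) (j - b) = 0"
    using assms by (auto simp: order_ge_def)
qed

lemma order_ge_0: "order_ge 0 f"
  by (simp add: order_ge_def)

lemma order_ge_mult_right: "order_ge r f \<Longrightarrow> order_ge r (f * g)"
  using order_ge_mult[of r f 0 g] by (simp add: order_ge_0)

lemma order_ge_power: "order_ge 1 f \<Longrightarrow> order_ge n (f ^ n)"
proof (induction n)
  case (Suc n)
  then show ?case using order_ge_mult[of 1 f n "f ^ n"] by simp
qed (simp add: order_ge_0)

lemma coef2_map_poly_pderiv: "coef2 (map_poly pderiv f) i j = of_nat (Suc i) * coef2 f (Suc i) j"
  by (simp add: coeff_map_poly coeff_pderiv)

lemma coef2_pderiv: "coef2 (pderiv f) i j = of_nat (Suc j) * coef2 f i (Suc j)"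
  by (simp add: coeff_pderiv coeff_of_nat_times del: of_nat_Suc)

text \<open>
  The recursion over first derivatives makes it immediate that the order drops by at most one under
  differentiation, which is what the polars of a curve need.
\<close>

fun vanishes_to_order :: "nat \<Rightarrow> complex ^ 3 \<Rightarrow> poly3 \<Rightarrow> bool" where
  "vanishes_to_order 0 v G \<longleftrightarrow> True"
| "vanishes_to_order (Suc r) v G \<longleftrightarrow> eval3 G v = 0 \<and> vanishes_to_order r v (partial_x G) \<and>
     vanishes_to_order r v (partial_y G) \<and> vanishes_to_order r v (partial_z G)"

text \<open>
  In characteristic zero, a polynomial belongs to the $(r+1)$-st power of the maximal ideal of the
  origin if it vanishes there and its first derivatives belong to the $r$-th power.
\<close>
lemma vanishes_to_order_local_exp:
  "vanishes_to_order r v G \<Longrightarrow> order_ge r (local_exp v G)"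
proof (induction r arbitrary: G)
  case (Suc r)
  obtain D D' where D: "D \<in> {partial_x, partial_y, partial_z}" "D' \<in> {partial_x, partial_y, partial_z}"
    and s: "\<And>G. map_poly pderiv (local_exp v G) = local_exp v (D G)"
    and t: "\<And>G. pderiv (local_exp v G) = local_exp v (D' G)"
    using local_exp_derivatives[of v] by blast
  have ord: "order_ge r (local_exp v (D G))" "order_ge r (local_exp v (D' G))"
    using D Suc by auto
  show ?case
    unfolding order_ge_def
  proof (intro allI impI)
    fix i j
    assume "i + j < Suc r"
    then consider "i = 0" "j = 0" | i' where "i = Suc i'" "i' + j < r"
      | j' where "j = Suc j'" "i + j' < r"
      by (cases i; cases j) auto
    then show "coef2 (local_exp v G) i j = 0"
    proof cases
      case 1
      then show ?thesis using Suc.prems by (simp add: local_exp_at_point)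
    next
      case 2
      then have "of_nat (Suc i') * coef2 (local_exp v G) (Suc i') j = 0"
        unfolding coef2_map_poly_pderiv[symmetric] s using ord(1) by (simp add: order_ge_def)
      then show ?thesis using 2 by (simp del: of_nat_Suc)
    next
      case 3
      then have "of_nat (Suc j') * coef2 (local_exp v G) i (Suc j') = 0"
        unfolding coef2_pderiv[symmetric] t using ord(2) by (simp add: order_ge_def)
      then show ?thesis using 3 by (simp del: of_nat_Suc)
    qed
  qed
qed (simp add: order_ge_0)

text \<open>
  Differentiating a Taylor coefficient away lowers the degree of the form, so that after more than
  \<open>n\<close> steps nothing is left.
\<close>
lemma local_exp_degree_le:
  assumes "homogeneous n G" "n < i + j"
  shows "coef2 (local_exp v G) i j = 0"
  using assms
proof (induction n arbitrary: G i j)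
  case 0
  then obtain c where "G = const3 c"
    using homogeneous_0_imp_const3 by blast
  with 0 show ?case
    by (auto simp: local_exp_const3 coeff_pCons split: nat.splits)
next
  case (Suc n)
  obtain D D' where D: "D \<in> {partial_x, partial_y, partial_z}" "D' \<in> {partial_x, partial_y, partial_z}"
    and s: "\<And>G. map_poly pderiv (local_exp v G) = local_exp v (D G)"
    and t: "\<And>G. pderiv (local_exp v G) = local_exp v (D' G)"
    using local_exp_derivatives[of v] by blast
  have hom: "homogeneous n (D G)" "homogeneous n (D' G)"
    using D homogeneous_partial[OF Suc.prems(1)] by auto
  consider i' where "i = Suc i'" "n < i' + j" | j' where "j = Suc j'" "n < i + j'"
    using Suc.prems(2) by (cases i; cases j) auto
  then show ?case
  proof cases
    case 1
    then have "of_nat (Suc i') * coef2 (local_exp v G) (Suc i') j = 0"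
      using Suc.IH[OF hom(1)] by (simp only: flip: s coef2_map_poly_pderiv)
    then show ?thesis using 1 by (simp del: of_nat_Suc)
  next
    case 2
    then have "of_nat (Suc j') * coef2 (local_exp v G) i (Suc j') = 0"
      using Suc.IH[OF hom(2)] by (simp only: flip: t coef2_pderiv)
    then show ?thesis using 2 by (simp del: of_nat_Suc)
  qed
qed

lemma partial_add: "partial_x (G + H) = partial_x G + partial_x H"
  "partial_y (G + H) = partial_y G + partial_y H" "partial_z (G + H) = partial_z G + partial_z H"
  by (rule poly3_eqI, simp add: coef3_partial_x coef3_partial_y coef3_partial_z algebra_simps)+

lemma partial_const3_mult: "partial_x (const3 c * G) = const3 c * partial_x G"
  "partial_y (const3 c * G) = const3 c * partial_y G" "partial_z (const3 c * G) = const3 c * partial_z G"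
  by (rule poly3_eqI, simp add: coef3_partial_x coef3_partial_y coef3_partial_z)+

lemma partial_commute: "partial_y (partial_x G) = partial_x (partial_y G)"
  "partial_z (partial_x G) = partial_x (partial_z G)" "partial_z (partial_y G) = partial_y (partial_z G)"
  by (rule poly3_eqI, simp add: coef3_partial_x coef3_partial_y coef3_partial_z)+

lemma vanishes_to_order_add:
  "vanishes_to_order r v G \<Longrightarrow> vanishes_to_order r v H \<Longrightarrow> vanishes_to_order r v (G + H)"
  by (induction r arbitrary: G H) (auto simp: partial_add eval3_def)

lemma vanishes_to_order_const3_mult:
  "vanishes_to_order r v G \<Longrightarrow> vanishes_to_order r v (const3 c * G)"
  by (induction r arbitrary: G)
    (auto simp: partial_const3_mult eval3_def simp del: mult_pCons_left)

text \<open>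
  All partial derivatives of order below the multiplicity vanish because the multiplicity is a least
  element; that they commute brings them into the order in which the recursion takes them.
\<close>
lemma vanishes_to_order_curve_mult:
  assumes "v \<in> P"
  shows "vanishes_to_order (curve_mult F P) v F"
proof -
  have funpow_commute: "(f ^^ n) (g x) = g ((f ^^ n) x)" if "\<And>x. f (g x) = g (f x)"
    for f g :: "poly3 \<Rightarrow> poly3" and n x
    by (induction n) (simp_all add: that)
  note zx = funpow_commute[of partial_z partial_x, OF partial_commute(2)]
    and zy = funpow_commute[of partial_z partial_y, OF partial_commute(3)]
    and yx = funpow_commute[of partial_y partial_x, OF partial_commute(1)]
  have "vanishes_to_order r v G"
    if "\<And>i j k. i + j + k < r \<Longrightarrow>
      eval3 ((partial_x ^^ i) ((partial_y ^^ j) ((partial_z ^^ k) G))) v = 0" for r G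
    using that
  proof (induction r arbitrary: G)
    case (Suc r)
    have "eval3 ((partial_x ^^ i) ((partial_y ^^ j) ((partial_z ^^ k) (partial_x G)))) v = 0"
      if "i + j + k < r" for i j k
      using Suc.prems[of "Suc i" j k] that by (simp add: zx yx funpow_swap1)
    moreover have "eval3 ((partial_x ^^ i) ((partial_y ^^ j) ((partial_z ^^ k) (partial_y G)))) v = 0"
      if "i + j + k < r" for i j k
      using Suc.prems[of i "Suc j" k] that by (simp add: zy funpow_swap1)
    moreover have "eval3 ((partial_x ^^ i) ((partial_y ^^ j) ((partial_z ^^ k) (partial_z G)))) v = 0"
      if "i + j + k < r" for i j k
      using Suc.prems[of i j "Suc k"] that by (simp add: funpow_swap1)
    moreover have "eval3 G v = 0"
      using Suc.prems[of 0 0 0] by simp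
    ultimately show ?case
      by (auto intro!: Suc.IH)
  qed simp
  moreover have "eval3 ((partial_x ^^ i) ((partial_y ^^ j) ((partial_z ^^ k) F))) v = 0"
    if "i + j + k < curve_mult F P" for i j k
    using not_less_Least[OF that[unfolded curve_mult_def]] assms by (auto simp: vanishes_at_def)
  ultimately show ?thesis by blast
qed

section \<open>Bezout's inequality with multiplicities\<close>

text \<open>
  Gaussian elimination: an equation in which some unknown occurs is used to eliminate that unknown.
\<close>
lemma underdetermined_system:
  fixes M :: "'u \<Rightarrow> 'e \<Rightarrow> 'k::field"
  assumes "finite E" "finite U" "card E < card U"
  shows "\<exists>x. (\<exists>u\<in>U. x u \<noteq> 0) \<and> (\<forall>e\<in>E. (\<Sum>u\<in>U. x u * M u e) = 0)"
  using assms
proof (induction E arbitrary: U M rule: finite_induct)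
  case empty
  then obtain u where "u \<in> U" by fastforce
  then show ?case
    by (intro exI[of _ "\<lambda>_. 1"]) auto
next
  case (insert e E)
  show ?case
  proof (cases "\<forall>u\<in>U. M u e = 0")
    case True
    obtain x where "\<exists>u\<in>U. x u \<noteq> 0" "\<forall>e\<in>E. (\<Sum>u\<in>U. x u * M u e) = 0"
      using insert.IH[of U M] insert.prems insert.hyps by auto
    with True show ?thesis
      by (intro exI[of _ x]) simp
  next
    case False
    then obtain v where v: "v \<in> U" "M v e \<noteq> 0" by blast
    define N where "N u f = M u f - M u e / M v e * M v f" for u f
    let ?U = "U - {v}"
    have "card E < card ?U"
      using insert.prems insert.hyps v by simp
    then obtain x where x: "\<exists>u\<in>?U. x u \<noteq> 0" "\<forall>f\<in>E. (\<Sum>u\<in>?U. x u * N u f) = 0"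
      using insert.IH[of ?U N] insert.prems by auto
    \<comment> \<open>The eliminated unknown takes the value that solves equation \<open>e\<close>.\<close>
    define y where "y = x(v := - (\<Sum>u\<in>?U. x u * M u e) / M v e)"
    have sum: "(\<Sum>u\<in>U. y u * M u f) = (\<Sum>u\<in>?U. x u * N u f)" for f
    proof -
      have "(\<Sum>u\<in>U. y u * M u f) = y v * M v f + (\<Sum>u\<in>?U. x u * M u f)"
        using insert.prems v by (simp add: sum.remove[of U v] y_def)
      also have "y v * M v f = - (\<Sum>u\<in>?U. x u * (M u e / M v e * M v f))"
        by (simp add: y_def sum_distrib_left sum_divide_distrib mult_ac)
      finally show ?thesis
        by (simp add: N_def right_diff_distrib sum_subtractf)
    qed
    have "(\<Sum>u\<in>?U. x u * N u e) = 0"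
      using v by (simp add: N_def)
    with x sum have "\<forall>f\<in>insert e E. (\<Sum>u\<in>U. y u * M u f) = 0"
      by simp
    moreover have "\<exists>u\<in>U. y u \<noteq> 0"
      using x(1) by (auto simp: y_def)
    ultimately show ?thesis by blast
  qed
qed

text \<open>
  The exponent of the leading monomial for the lexicographic order with $z > y > x$.
\<close>
definition lead_exponent :: "poly3 \<Rightarrow> nat \<times> nat \<times> nat" where
  "lead_exponent B = (let b = lead_coeff B; b' = lead_coeff b
     in (Polynomial.degree b', Polynomial.degree b, Polynomial.degree B))"

text \<open>
  The monomials of degree \<open>n\<close> that are not divisible by the leading monomial of \<open>B\<close>. They are a basis
  of a complement of the multiples of \<open>B\<close> among the forms of degree \<open>n\<close>.
\<close>
definition reduced_exponents :: "poly3 \<Rightarrow> nat \<Rightarrow> (nat \<times> nat \<times> nat) set" where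
  "reduced_exponents B n =
     (case lead_exponent B of (a, b, c) \<Rightarrow> {(i, j, k) \<in> exponents n. \<not> (a \<le> i \<and> b \<le> j \<and> c \<le> k)})"

lemma lead_exponent_mult:
  assumes "lead_exponent A = (a, b, c)" "lead_exponent B = (a', b', c')" "A \<noteq> 0" "B \<noteq> 0"
  shows "lead_exponent (A * B) = (a + a', b + b', c + c')"
  using assms by (auto simp: lead_exponent_def Let_def degree_mult_eq coeff_mult_degree_sum)

lemma coef3_lead_exponent:
  assumes "lead_exponent B = (a, b, c)" "B \<noteq> 0"
  shows "coef3 B a b c \<noteq> 0"
  using assms by (auto simp: lead_exponent_def Let_def)

text \<open>
  The leading monomial of a nonzero multiple of \<open>B\<close> is divisible by that of \<open>B\<close>.
\<close>
lemma reduced_not_dvd: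
  assumes "B dvd P" "\<And>i j k. coef3 P i j k \<noteq> 0 \<Longrightarrow> (i, j, k) \<in> reduced_exponents B n"
  shows "P = 0"
proof (rule ccontr)
  assume "P \<noteq> 0"
  with assms(1) obtain S where S: "P = B * S" "B \<noteq> 0" "S \<noteq> 0" by auto
  obtain a b c where lB: "lead_exponent B = (a, b, c)" by (cases "lead_exponent B")
  obtain a' b' c' where lS: "lead_exponent S = (a', b', c')" by (cases "lead_exponent S")
  have "coef3 P (a + a') (b + b') (c + c') \<noteq> 0"
    using coef3_lead_exponent[OF lead_exponent_mult[OF lB lS]] S by simp
  then have "(a + a', b + b', c + c') \<in> reduced_exponents B n"
    by (rule assms(2))
  then show False
    by (simp add: reduced_exponents_def lB)
qed

lemma card_reduced_exponents:
  assumes "homogeneous b B" "B \<noteq> 0" "b \<le> n"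
  shows "card (reduced_exponents B n) + card (exponents (n - b)) = card (exponents n)"
proof -
  obtain p q r where l: "lead_exponent B = (p, q, r)" by (cases "lead_exponent B")
  have pqr: "p + q + r = b"
    using coef3_lead_exponent[OF l assms(2)] assms(1) by (auto simp: homogeneous_def)
  let ?sh = "\<lambda>(i, j, k). (i + p, j + q, k + r)"
  have "exponents n = reduced_exponents B n \<union> ?sh ` exponents (n - b)"
  proof (intro equalityI subsetI)
    fix \<mu>
    assume \<mu>: "\<mu> \<in> exponents n"
    obtain i j k where ijk: "\<mu> = (i, j, k)" by (cases \<mu>)
    show "\<mu> \<in> reduced_exponents B n \<union> ?sh ` exponents (n - b)"
    proof (cases "p \<le> i \<and> q \<le> j \<and> r \<le> k")
      case True
      then have "\<mu> = ?sh (i - p, j - q, k - r)" "(i - p, j - q, k - r) \<in> exponents (n - b)"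
        using \<mu> pqr by (auto simp: ijk exponents_def)
      then show ?thesis by blast
    next
      case False
      with \<mu> show ?thesis by (simp add: ijk reduced_exponents_def l)
    qed
  next
    fix \<mu>
    assume "\<mu> \<in> reduced_exponents B n \<union> ?sh ` exponents (n - b)"
    then show "\<mu> \<in> exponents n"
      using pqr assms(3) by (auto simp: reduced_exponents_def l exponents_def)
  qed
  moreover have "card (reduced_exponents B n \<union> ?sh ` exponents (n - b)) =
      card (reduced_exponents B n) + card (?sh ` exponents (n - b))"
    by (rule card_Un_disjoint)
      (auto simp: finite_exponents reduced_exponents_def l intro: finite_subset[OF _ finite_exponents[of n]])
  moreover have "card (?sh ` exponents (n - b)) = card (exponents (n - b))"
    by (rule card_image) (auto simp: inj_on_def)
  ultimately show ?thesis by simp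
qed

text \<open>
  These are the linear functionals that factor through finite jets at the points of \<open>S\<close>.
\<close>
definition jet_functional ::
    "(complex ^ 3 \<Rightarrow> nat) \<Rightarrow> (complex ^ 3) set \<Rightarrow> ((complex ^ 3) \<times> nat \<times> nat \<Rightarrow> complex) \<Rightarrow> poly3 \<Rightarrow> complex"
  where "jet_functional N S l G = (\<Sum>v\<in>S. \<Sum>(i, j)\<in>triangle (N v). l (v, i, j) * coef2 (local_exp v G) i j)"

lemma jet_functional_add: "jet_functional N S l (G + H) = jet_functional N S l G + jet_functional N S l H"
  by (simp add: jet_functional_def local_exp.hom_add algebra_simps case_prod_unfold sum.distrib)

lemma jet_functional_const3_mult: "jet_functional N S l (const3 c * G) = c * jet_functional N S l G"
  by (simp only: jet_functional_def local_exp.hom_mult local_exp_const3)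
    (simp add: sum_distrib_left case_prod_unfold mult_ac)

lemma jet_functional_sum: "jet_functional N S l (sum f I) = (\<Sum>x\<in>I. jet_functional N S l (f x))"
proof (induction I rule: infinite_finite_induct)
qed (auto simp: jet_functional_add, auto simp: jet_functional_def local_exp.hom_zero)

text \<open>
  The three linear forms $w_j x_i - w_i x_j$ vanish at \<open>w\<close>, and they vanish simultaneously only at the
  multiples of \<open>w\<close>.
\<close>

lemma separating_line:
  fixes v w :: "complex ^ 3"
  assumes "w \<noteq> 0" "\<And>t. v \<noteq> t *s w"
  obtains L where "homogeneous 1 L" "eval3 L w = 0" "eval3 L v \<noteq> 0"
proof -
  have lin: "homogeneous 1 (const3 a * X3 + const3 b * Y3 + const3 c * Z3)" for a b c
    by (intro homogeneous_add homogeneous_const3_mult homogeneous_X3 homogeneous_Y3 homogeneous_Z3)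
  have ev: "eval3 (const3 a * X3 + const3 b * Y3 + const3 c * Z3) u = a * u $ 1 + b * u $ 2 + c * u $ 3"
    for a b c u by (simp add: eval3_def algebra_simps)
  have "v $ 1 * w $ 2 \<noteq> v $ 2 * w $ 1 \<or> v $ 1 * w $ 3 \<noteq> v $ 3 * w $ 1 \<or> v $ 2 * w $ 3 \<noteq> v $ 3 * w $ 2"
  proof (rule ccontr)
    assume "\<not> ?thesis"
    then have eq: "v $ i * w $ j = v $ j * w $ i" for i j
      using exhaust_3[of i] exhaust_3[of j] by auto
    obtain k where k: "w $ k \<noteq> 0"
      using assms(1) by (auto simp: vec_eq_iff)
    have "v = (v $ k / w $ k) *s w"
      using k eq[of _ k] by (auto simp: vec_eq_iff field_simps)
    with assms(2) show False by blast
  qed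
  then consider "v $ 1 * w $ 2 - v $ 2 * w $ 1 \<noteq> 0" | "v $ 1 * w $ 3 - v $ 3 * w $ 1 \<noteq> 0"
    | "v $ 2 * w $ 3 - v $ 3 * w $ 2 \<noteq> 0" by force
  then show thesis
  proof cases
    case 1
    then show thesis
      by (intro that[OF lin[of "w $ 2" "- w $ 1" 0]]) (simp_all only: ev, simp_all add: algebra_simps)
  next
    case 2
    then show thesis
      by (intro that[OF lin[of "w $ 3" 0 "- w $ 1"]]) (simp_all only: ev, simp_all add: algebra_simps)
  next
    case 3
    then show thesis
      by (intro that[OF lin[of 0 "w $ 3" "- w $ 2"]]) (simp_all only: ev, simp_all add: algebra_simps)
  qed
qed

lemma coef2_S2_T2_mult:
  "coef2 (S2 ^ a * T2 ^ b * f) i j = (if a \<le> i \<and> b \<le> j then coef2 f (i - a) (j - b) else 0)"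
proof -
  have "S2 ^ a * T2 ^ b = monom (monom 1 a) b"
  proof -
    have "S2 ^ a = monom (monom 1 a) 0"
      by (induction a) (simp_all add: monom_Suc monom_0 one_pCons)
    moreover have "T2 ^ b = monom 1 b"
      by (induction b) (simp_all add: monom_Suc monom_0 flip: one_pCons)
    ultimately show ?thesis by (simp add: mult_monom)
  qed
  then show ?thesis
    by (simp add: coeff_monom_mult)
qed

text \<open>
  Forms of large degree take arbitrary Taylor coefficients at finitely many points, so a functional
  of this kind that vanishes on them has only zero weights. If some weight at \<open>v\<close> is nonzero, let
  $(a, b)$ be the exponent of such a weight with $a + b$ maximal. The test form is the product of
  $U^a V^b$ with high powers of lines through the other points that avoid \<open>v\<close>, filled up to the
  right degree with the form \<open>W\<close> that expands to \<open>1\<close> at \<open>v\<close>. It has no Taylor coefficients of small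
  order at the other points, and at \<open>v\<close> its expansion is a nonzero multiple of $s^a t^b$ up to terms
  of higher order, whose weights vanish by the choice of $(a, b)$.
\<close>
lemma jet_functional_separates:
  fixes S :: "(complex ^ 3) set"
  assumes fin: "finite S" and nz: "0 \<notin> S"
    and distinct: "\<And>v w t. v \<in> S \<Longrightarrow> w \<in> S \<Longrightarrow> v = t *s w \<Longrightarrow> v = w"
    and N: "\<And>v. v \<in> S \<Longrightarrow> N v \<le> K"
    and n: "K * Suc (card S) \<le> n"
    and vanish: "\<And>G. homogeneous n G \<Longrightarrow> jet_functional N S l G = 0"
    and v: "v \<in> S" "(i, j) \<in> triangle (N v)"
  shows "l (v, i, j) = 0"
proof (rule ccontr)
  assume "l (v, i, j) \<noteq> 0"
  define J where "J = {(i, j) \<in> triangle (N v). l (v, i, j) \<noteq> 0}"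
  have finJ: "finite J"
    by (rule finite_subset[OF _ finite_triangle[of "N v"]]) (auto simp: J_def)
  moreover have "J \<noteq> {}"
    using v \<open>l (v, i, j) \<noteq> 0\<close> by (auto simp: J_def)
  ultimately have "Max ((\<lambda>(i, j). i + j) ` J) \<in> (\<lambda>(i, j). i + j) ` J"
    by (intro Max_in) auto
  then obtain a b where ab: "(a, b) \<in> J" "Max ((\<lambda>(i, j). i + j) ` J) = a + b"
    by auto
  have max: "i + j \<le> a + b" if "(i, j) \<in> J" for i j
  proof -
    have "(\<lambda>(i, j). i + j) (i, j) \<in> (\<lambda>(i, j). i + j) ` J"
      using that by (rule imageI)
    then show ?thesis
      using Max_ge[of "(\<lambda>(i, j). i + j) ` J"] finJ ab(2) by simp
  qed
  obtain U V W where UVW: "homogeneous 1 U" "homogeneous 1 V" "homogeneous 1 W"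
    "local_exp v U = S2" "local_exp v V = T2" "local_exp v W = 1"
    using local_frame[of v] nz v by metis
  have "\<exists>L. homogeneous 1 L \<and> eval3 L w = 0 \<and> eval3 L v \<noteq> 0" if "w \<in> S - {v}" for w
    using separating_line[of w v] that nz distinct v by (metis DiffE insertCI)
  then obtain L where L: "\<And>w. w \<in> S - {v} \<Longrightarrow> homogeneous 1 (L w)"
    "\<And>w. w \<in> S - {v} \<Longrightarrow> eval3 (L w) w = 0" "\<And>w. w \<in> S - {v} \<Longrightarrow> eval3 (L w) v \<noteq> 0"
    by metis
  define M where "M = (\<Prod>w\<in>S - {v}. L w ^ K)"
  have homM: "homogeneous (card (S - {v}) * K) M"
    unfolding M_def by (rule homogeneous_prod) (use L(1) homogeneous_power[of 1] in force)
  have deg: "a + b + card (S - {v}) * K \<le> n"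
  proof -
    have "a + b \<le> K"
      using ab(1) N[OF v(1)] by (auto simp: J_def triangle_def)
    moreover have "card (S - {v}) * K \<le> K * card S"
      unfolding mult.commute[of K] by (intro mult_le_mono1 card_mono fin) blast
    ultimately show ?thesis using n unfolding mult_Suc_right by linarith
  qed
  define G where "G = U ^ a * V ^ b * M * W ^ (n - (a + b + card (S - {v}) * K))"
  have "homogeneous n G"
    using homogeneous_mult[OF homogeneous_mult[OF homogeneous_mult[OF homogeneous_power[OF UVW(1), of a]
            homogeneous_power[OF UVW(2), of b]] homM]
        homogeneous_power[OF UVW(3), of "n - (a + b + card (S - {v}) * K)"]] deg
    by (simp add: G_def)
  then have "jet_functional N S l G = 0"
    by (rule vanish)
  have expv: "local_exp v G = S2 ^ a * T2 ^ b * local_exp v M"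
    by (simp only: G_def local_exp.hom_mult local_exp.hom_power UVW power_one mult_1_right)
  have M0: "coef2 (local_exp v M) 0 0 \<noteq> 0"
  proof -
    have "eval3 M v = (\<Prod>w\<in>S - {v}. eval3 (L w) v ^ K)"
      unfolding M_def eval3_def by (simp add: poly_prod poly_power)
    then show ?thesis
      using L(3) fin by (simp add: local_exp_at_point)
  qed
  have other: "coef2 (local_exp w G) i j = 0" if "w \<in> S - {v}" "(i, j) \<in> triangle (N w)" for w i j
  proof -
    have "order_ge 1 (local_exp w (L w))"
      using L(2)[OF that(1)] by (simp add: order_ge_def local_exp_at_point)
    then have ord: "order_ge K (local_exp w (L w ^ K))"
      unfolding local_exp.hom_power by (rule order_ge_power)
    have "M = L w ^ K * (\<Prod>u\<in>S - {v} - {w}. L u ^ K)"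
      unfolding M_def using fin that by (simp add: prod.remove)
    then have "G = L w ^ K * ((\<Prod>u\<in>S - {v} - {w}. L u ^ K) * U ^ a * V ^ b
        * W ^ (n - (a + b + card (S - {v}) * K)))"
      unfolding G_def by (simp add: mult_ac)
    then have "order_ge K (local_exp w G)"
      using order_ge_mult_right[OF ord] by (simp only: local_exp.hom_mult)
    then show ?thesis
      using N[of w] that by (auto simp: order_ge_def triangle_def)
  qed
  have "jet_functional N S l G = (\<Sum>(i, j)\<in>triangle (N v). l (v, i, j) * coef2 (local_exp v G) i j)"
  proof -
    have "(\<Sum>w\<in>S - {v}. \<Sum>(i, j)\<in>triangle (N w). l (w, i, j) * coef2 (local_exp w G) i j) = 0"
      by (intro sum.neutral ballI) (auto simp: other)
    then show ?thesis
      unfolding jet_functional_def using fin v(1) by (simp add: sum.remove[of S v])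
  qed
  also have "\<dots> = (\<Sum>\<mu>\<in>triangle (N v). if \<mu> = (a, b) then l (v, a, b) * coef2 (local_exp v M) 0 0 else 0)"
  proof (intro sum.cong refl, safe)
    fix i j
    assume ij: "(i, j) \<in> triangle (N v)"
    show "l (v, i, j) * coef2 (local_exp v G) i j =
      (if (i, j) = (a, b) then l (v, a, b) * coef2 (local_exp v M) 0 0 else 0)"
    proof (cases "l (v, i, j) = 0 \<or> (i, j) = (a, b)")
      case False
      then have "i + j \<le> a + b"
        using max ij by (simp add: J_def)
      with False have "\<not> (a \<le> i \<and> b \<le> j)" by auto
      with False show ?thesis by (auto simp: expv coef2_S2_T2_mult)
    qed (use ab(1) in \<open>auto simp: expv coef2_S2_T2_mult J_def\<close>)
  qed
  also have "\<dots> = l (v, a, b) * coef2 (local_exp v M) 0 0"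
    using ab(1) by (simp add: finite_triangle J_def)
  finally show False
    using \<open>jet_functional N S l G = 0\<close> M0 ab(1) by (simp add: J_def)
qed


text \<open>
  A coefficient of order less than \<open>r + s\<close> of the product with a polynomial of order \<open>r\<close> only sees the
  coefficients of order less than \<open>s\<close> of the other factor.
\<close>
lemma coef2_mult_truncated:
  assumes "order_ge r g" "i + j < r + s"
  shows "coef2 (g * f) i j = (\<Sum>(p, q)\<in>triangle s. coef2 f p q * coef2 (S2 ^ p * T2 ^ q * g) i j)"
proof -
  have "coef2 (g * f) i j = (\<Sum>q\<le>j. \<Sum>p\<le>i. coef2 f p q * coef2 g (i - p) (j - q))"
    by (simp only: mult.commute[of g f] coef2_mult)
  also have "\<dots> = (\<Sum>(p, q)\<in>{..i} \<times> {..j}. coef2 f p q * coef2 g (i - p) (j - q))"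
    by (subst sum.swap) (simp add: sum.cartesian_product)
  also have "\<dots> = (\<Sum>(p, q)\<in>triangle s. coef2 f p q * coef2 (S2 ^ p * T2 ^ q * g) i j)"
  proof (rule sum.mono_neutral_cong)
    show "finite (triangle s)" "finite ({..i} \<times> {..j})"
      by (auto simp: finite_triangle)
  next
    fix \<mu>
    assume "\<mu> \<in> {..i} \<times> {..j} - triangle s"
    then show "(case \<mu> of (p, q) \<Rightarrow> coef2 f p q * coef2 g (i - p) (j - q)) = 0"
      using assms by (auto simp: triangle_def order_ge_def)
  qed (auto simp: coef2_S2_T2_mult split: if_splits)
  finally show ?thesis .
qed

lemma coef3_sum_mono3:
  assumes "finite I"
  shows "coef3 (\<Sum>\<mu>\<in>I. const3 (c \<mu>) * mono3 \<mu>) i j k = (if (i, j, k) \<in> I then c (i, j, k) else 0)"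
proof -
  have "coef3 (\<Sum>\<mu>\<in>I. const3 (c \<mu>) * mono3 \<mu>) i j k =
      (\<Sum>\<mu>\<in>I. if \<mu> = (i, j, k) then c (i, j, k) else 0)"
    unfolding coeff_sum
  proof (rule sum.cong[OF refl])
    fix \<mu> :: "nat \<times> nat \<times> nat"
    obtain p q r where "\<mu> = (p, q, r)" by (cases \<mu>)
    then show "coef3 (const3 (c \<mu>) * mono3 \<mu>) i j k = (if \<mu> = (i, j, k) then c (i, j, k) else 0)"
      by (auto simp: coef3_mono3)
  qed
  then show ?thesis
    using assms by (auto intro!: sum.neutral)
qed

text \<open>
  The dimension count is carried out with a single system of linear equations. The unknowns are
  the coefficients of \<open>P\<close>, restricted to monomials that are reduced with respect to \<open>B\<close>, the
  coefficients of \<open>Q\<close>, and the complex conjugates of the weights \<open>l\<close> of a functional on the Taylor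
  coefficients of order less than \<open>r v + s v\<close>. The equations say that the functional annihilates all
  multiples of \<open>A\<close> and of \<open>B\<close>, and that on each monomial its conjugate is minus the corresponding
  coefficient of \<open>Y = A * P + B * Q\<close>. If the inequality were false, there would be more unknowns than
  equations. For a nontrivial solution the value of the functional at \<open>Y\<close> is on the one hand zero and
  on the other hand minus the sum of the squared absolute values of the coefficients of \<open>Y\<close>. Hence
  \<open>Y = 0\<close>, so \<open>P\<close> and \<open>Q\<close> vanish by coprimality, and the functional is zero on all forms of degree
  \<open>n\<close>, so its weights vanish. The Hermitian pairing takes the place of the choice of a complement of
  the forms \<open>A * P + B * Q\<close>.
\<close>
lemma bezout_inequality:
  fixes A B :: poly3 and S :: "(complex ^ 3) set"
  assumes homA: "homogeneous a A" and homB: "homogeneous b B"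
    and nzA: "A \<noteq> 0" and nzB: "B \<noteq> 0" and cop: "coprime A B"
    and fin: "finite S" and nz: "0 \<notin> S"
    and distinct: "\<And>v w t. v \<in> S \<Longrightarrow> w \<in> S \<Longrightarrow> v = t *s w \<Longrightarrow> v = w"
    and ordA: "\<And>v. v \<in> S \<Longrightarrow> order_ge (r v) (local_exp v A)"
    and ordB: "\<And>v. v \<in> S \<Longrightarrow> order_ge (s v) (local_exp v B)"
  shows "(\<Sum>v\<in>S. r v * s v) \<le> a * b"
proof (rule ccontr)
  assume "\<not> ?thesis"
  then have less: "a * b < (\<Sum>v\<in>S. r v * s v)" by simp
  define N where "N v = r v + s v" for v
  define K where "K = (\<Sum>v\<in>S. N v)"
  define m where "m = K * Suc (card S)"
  define n where "n = m + a + b"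
  define J where "J = Sigma S (\<lambda>v. triangle (N v))"
  define U where "U = reduced_exponents B (n - a) <+> exponents (n - b) <+> J"
  define E where "E = exponents n <+> Sigma S (\<lambda>v. triangle (s v)) <+> Sigma S (\<lambda>v. triangle (r v))"
  define cf where "cf G \<mu> = (case \<mu> of (i, j, k) \<Rightarrow> coef3 G i j k)" for G \<mu>
  \<comment> \<open>The equation indexed by \<open>\<mu>\<close> says that the functional kills \<open>g\<close> times the monomial \<open>\<mu>\<close> at its point.\<close>
  define lc where "lc g \<xi> \<mu> = (case (\<xi>, \<mu>) of ((v, i, j), (w, p, q)) \<Rightarrow>
    if v = w then cnj (coef2 (S2 ^ p * T2 ^ q * local_exp v g) i j) else 0)"
    for g and \<xi> \<mu> :: "(complex ^ 3) \<times> nat \<times> nat"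
  define M where "M u e = (case e of
      Inl \<nu> \<Rightarrow> (case u of Inl \<mu> \<Rightarrow> cf (A * mono3 \<mu>) \<nu>
        | Inr (Inl \<mu>) \<Rightarrow> cf (B * mono3 \<mu>) \<nu>
        | Inr (Inr (v, i, j)) \<Rightarrow> cnj (coef2 (local_exp v (mono3 \<nu>)) i j))
    | Inr (Inl \<mu>) \<Rightarrow> (case u of Inr (Inr \<xi>) \<Rightarrow> lc A \<xi> \<mu> | _ \<Rightarrow> 0)
    | Inr (Inr \<mu>) \<Rightarrow> (case u of Inr (Inr \<xi>) \<Rightarrow> lc B \<xi> \<mu> | _ \<Rightarrow> 0))" for u e
  have finR: "finite (reduced_exponents B (n - a))"
    by (rule finite_subset[OF _ finite_exponents[of "n - a"]])
      (auto simp: reduced_exponents_def split: prod.splits)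
  have finJ: "finite J"
    unfolding J_def using fin by (auto simp: finite_triangle)
  have finU: "finite U" and finE: "finite E"
    unfolding U_def E_def using finR finJ fin by (auto simp: finite_exponents finite_triangle)
  have "card E < card U"
  proof -
    have cR: "card (reduced_exponents B (n - a)) + card (exponents m) = card (exponents (m + b))"
      using card_reduced_exponents[OF homB nzB, of "n - a"] by (simp add: n_def)
    have cE: "card E = card (exponents n) +
        ((\<Sum>v\<in>S. card (triangle (s v))) + (\<Sum>v\<in>S. card (triangle (r v))))"
      unfolding E_def using fin by (simp add: card_Plus finite_exponents finite_triangle card_SigmaI)
    have cU: "card U = card (reduced_exponents B (n - a)) +
        (card (exponents (m + a)) + (\<Sum>v\<in>S. card (triangle (N v))))"
      unfolding U_def J_def using fin finR
      by (simp add: card_Plus finite_exponents finite_triangle card_SigmaI n_def)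
    have tri: "(\<Sum>v\<in>S. card (triangle (N v))) = (\<Sum>v\<in>S. card (triangle (s v))) +
        (\<Sum>v\<in>S. card (triangle (r v))) + (\<Sum>v\<in>S. r v * s v)"
    proof -
      have "card (triangle (N v)) = card (triangle (s v)) + card (triangle (r v)) + r v * s v" for v
        using card_triangle[of "N v"] card_triangle[of "s v"] card_triangle[of "r v"]
        by (simp add: N_def algebra_simps)
      then show ?thesis by (simp add: sum.distrib)
    qed
    have arith: "e < u"
      if "cr + em = emb" "e = en + (ss + rs)" "u = cr + (ema + tn)" "tn = ss + rs + t"
        "emb + ema + ab = en + em" "ab < t" for e u cr em emb en ss rs ema tn t ab :: nat
      using that by linarith
    have "card (exponents (m + b)) + card (exponents (m + a)) + a * b = card (exponents n) + card (exponents m)"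
      using card_exponents[of "m + a"] card_exponents[of "m + b"] card_exponents[of n] card_exponents[of m]
      by (simp add: n_def algebra_simps)
    then show ?thesis by (rule arith[OF cR cE cU tri _ less])
  qed
  then obtain x where x0: "\<exists>u\<in>U. x u \<noteq> 0" and xE: "\<And>e. e \<in> E \<Longrightarrow> (\<Sum>u\<in>U. x u * M u e) = 0"
    using underdetermined_system[OF finE finU, of M] by blast
  define c where "c \<mu> = x (Inl \<mu>)" for \<mu>
  define d where "d \<mu> = x (Inr (Inl \<mu>))" for \<mu>
  define l where "l \<xi> = cnj (x (Inr (Inr \<xi>)))" for \<xi>
  define P where "P = (\<Sum>\<mu>\<in>reduced_exponents B (n - a). const3 (c \<mu>) * mono3 \<mu>)"
  define Q where "Q = (\<Sum>\<mu>\<in>exponents (n - b). const3 (d \<mu>) * mono3 \<mu>)"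
  define Y where "Y = A * P + B * Q"
  have sumU: "(\<Sum>u\<in>U. x u * M u e) = (\<Sum>\<mu>\<in>reduced_exponents B (n - a). c \<mu> * M (Inl \<mu>) e)
      + ((\<Sum>\<mu>\<in>exponents (n - b). d \<mu> * M (Inr (Inl \<mu>)) e)
      + (\<Sum>v\<in>S. \<Sum>\<mu>\<in>triangle (N v). cnj (l (v, \<mu>)) * M (Inr (Inr (v, \<mu>))) e))" for e
    unfolding U_def J_def using fin finR
    by (simp add: sum.Plus finite_exponents finite_triangle sum.Sigma c_def d_def l_def case_prod_unfold)
  have cf_sum: "cf (G * (\<Sum>\<mu>\<in>I. const3 (f \<mu>) * mono3 \<mu>)) \<nu> = (\<Sum>\<mu>\<in>I. f \<mu> * cf (G * mono3 \<mu>) \<nu>)"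
    for G I f \<nu>
  proof -
    have "G * (\<Sum>\<mu>\<in>I. const3 (f \<mu>) * mono3 \<mu>) = (\<Sum>\<mu>\<in>I. const3 (f \<mu>) * (G * mono3 \<mu>))"
      by (simp only: sum_distrib_left mult.left_commute)
    then show ?thesis
      by (simp add: cf_def coeff_sum split: prod.splits)
  qed
  have Y_eq: "cf Y \<nu> = - cnj (jet_functional N S l (mono3 \<nu>))" if "\<nu> \<in> exponents n" for \<nu>
  proof -
    have "(\<Sum>u\<in>U. x u * M u (Inl \<nu>)) = 0"
      using that by (intro xE) (auto simp: E_def)
    moreover have "(\<Sum>u\<in>U. x u * M u (Inl \<nu>)) = cf Y \<nu> + cnj (jet_functional N S l (mono3 \<nu>))"
    proof -
      have "cf Y \<nu> = cf (A * P) \<nu> + cf (B * Q) \<nu>"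
        by (simp add: Y_def cf_def split: prod.splits)
      then show ?thesis
        unfolding sumU P_def Q_def cf_sum
        by (simp add: M_def jet_functional_def case_prod_unfold)
    qed
    ultimately show ?thesis by (simp add: add_eq_0_iff)
  qed
  \<comment> \<open>It suffices to annihilate the products with monomials of order less than \<open>t'\<close>.\<close>
  have kill: "(\<Sum>(i, j)\<in>triangle (N v). l (v, i, j) * coef2 (local_exp v G * f) i j) = 0"
    if v: "v \<in> S" and ord: "order_ge t (local_exp v G)" and t: "t + t' = N v"
      and eq: "\<And>p q. (p, q) \<in> triangle t' \<Longrightarrow>
        (\<Sum>w\<in>S. \<Sum>\<mu>\<in>triangle (N w). cnj (l (w, \<mu>)) * lc G (w, \<mu>) (v, p, q)) = 0"
    for v G t t' f
  proof -
    have eq': "(\<Sum>(i, j)\<in>triangle (N v). l (v, i, j) * coef2 (S2 ^ p * T2 ^ q * local_exp v G) i j) = 0"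
      if "(p, q) \<in> triangle t'" for p q
    proof -
      have "(\<Sum>w\<in>S. \<Sum>\<mu>\<in>triangle (N w). cnj (l (w, \<mu>)) * lc G (w, \<mu>) (v, p, q)) =
          (\<Sum>w\<in>S. if w = v then \<Sum>\<mu>\<in>triangle (N v). cnj (l (v, \<mu>)) * lc G (v, \<mu>) (v, p, q) else 0)"
        by (intro sum.cong refl) (auto simp: lc_def intro!: sum.neutral)
      also have "\<dots> = (\<Sum>\<mu>\<in>triangle (N v). cnj (l (v, \<mu>)) * lc G (v, \<mu>) (v, p, q))"
        using v fin by simp
      also have "\<dots> = cnj (\<Sum>(i, j)\<in>triangle (N v). l (v, i, j) * coef2 (S2 ^ p * T2 ^ q * local_exp v G) i j)"
        by (simp add: lc_def case_prod_unfold)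
      finally have conj: "(\<Sum>w\<in>S. \<Sum>\<mu>\<in>triangle (N w). cnj (l (w, \<mu>)) * lc G (w, \<mu>) (v, p, q)) =
          cnj (\<Sum>(i, j)\<in>triangle (N v). l (v, i, j) * coef2 (S2 ^ p * T2 ^ q * local_exp v G) i j)" .
      show ?thesis
        using eq[OF that] unfolding conj by (rule iffD1[OF complex_cnj_zero_iff])
    qed
    have "(\<Sum>(i, j)\<in>triangle (N v). l (v, i, j) * coef2 (local_exp v G * f) i j) =
        (\<Sum>(i, j)\<in>triangle (N v). \<Sum>(p, q)\<in>triangle t'.
          coef2 f p q * (l (v, i, j) * coef2 (S2 ^ p * T2 ^ q * local_exp v G) i j))"
    proof (intro sum.cong refl, safe)
      fix i j
      assume "(i, j) \<in> triangle (N v)"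
      then have ij: "i + j < t + t'"
        using t by (simp add: triangle_def)
      show "l (v, i, j) * coef2 (local_exp v G * f) i j = (\<Sum>(p, q)\<in>triangle t'.
          coef2 f p q * (l (v, i, j) * coef2 (S2 ^ p * T2 ^ q * local_exp v G) i j))"
        unfolding coef2_mult_truncated[OF ord ij]
        by (simp only: sum_distrib_left case_prod_unfold mult.left_commute)
    qed
    also have "\<dots> = (\<Sum>(p, q)\<in>triangle t'. coef2 f p q *
        (\<Sum>(i, j)\<in>triangle (N v). l (v, i, j) * coef2 (S2 ^ p * T2 ^ q * local_exp v G) i j))"
      by (simp only: case_prod_unfold sum_distrib_left) (rule sum.swap)
    also have "\<dots> = 0"
      by (intro sum.neutral ballI) (auto simp only: eq' mult_zero_right split: prod.splits)
    finally show ?thesis .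
  qed
  have killA: "jet_functional N S l (A * f) = 0" for f
  proof -
    have "(\<Sum>(i, j)\<in>triangle (N v). l (v, i, j) * coef2 (local_exp v A * local_exp v f) i j) = 0"
      if v: "v \<in> S" for v
    proof (rule kill[OF v ordA[OF v], of "s v"])
      fix p q
      assume "(p, q) \<in> triangle (s v)"
      then have "(\<Sum>u\<in>U. x u * M u (Inr (Inl (v, p, q)))) = 0"
        using v by (intro xE) (auto simp: E_def)
      then show "(\<Sum>w\<in>S. \<Sum>\<mu>\<in>triangle (N w). cnj (l (w, \<mu>)) * lc A (w, \<mu>) (v, p, q)) = 0"
        unfolding sumU by (simp add: M_def)
    qed (simp add: N_def)
    then show ?thesis
      by (simp add: jet_functional_def local_exp.hom_mult)
  qed
  have killB: "jet_functional N S l (B * f) = 0" for f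
  proof -
    have "(\<Sum>(i, j)\<in>triangle (N v). l (v, i, j) * coef2 (local_exp v B * local_exp v f) i j) = 0"
      if v: "v \<in> S" for v
    proof (rule kill[OF v ordB[OF v], of "r v"])
      fix p q
      assume "(p, q) \<in> triangle (r v)"
      then have "(\<Sum>u\<in>U. x u * M u (Inr (Inr (v, p, q)))) = 0"
        using v by (intro xE) (auto simp: E_def)
      then show "(\<Sum>w\<in>S. \<Sum>\<mu>\<in>triangle (N w). cnj (l (w, \<mu>)) * lc B (w, \<mu>) (v, p, q)) = 0"
        unfolding sumU by (simp add: M_def)
    qed (simp add: N_def)
    then show ?thesis
      by (simp add: jet_functional_def local_exp.hom_mult)
  qed
  have homP: "homogeneous (n - a) P" and homQ: "homogeneous (n - b) Q"
    unfolding P_def Q_def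
    by (intro homogeneous_sum homogeneous_const3_mult homogeneous_mono3,
        simp add: reduced_exponents_def split: prod.splits)+
  have homY: "homogeneous n Y"
    using homogeneous_mult[OF homA homP] homogeneous_mult[OF homB homQ]
    by (simp add: Y_def homogeneous_add n_def add_ac)
  have expand: "jet_functional N S l G = (\<Sum>\<nu>\<in>exponents n. cf G \<nu> * jet_functional N S l (mono3 \<nu>))"
    if "homogeneous n G" for G
    by (subst homogeneous_expand[OF that])
      (simp only: jet_functional_sum case_prod_unfold jet_functional_const3_mult cf_def prod.collapse)
  have "jet_functional N S l Y = 0"
    by (simp add: Y_def jet_functional_add killA killB)
  moreover have "jet_functional N S l Y = - of_real (\<Sum>\<nu>\<in>exponents n. (cmod (cf Y \<nu>))\<^sup>2)"
  proof -
    have "jet_functional N S l (mono3 \<nu>) = - cnj (cf Y \<nu>)" if "\<nu> \<in> exponents n" for \<nu>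
      using Y_eq[OF that] by simp
    then show ?thesis
      unfolding expand[OF homY] by (simp add: sum_negf flip: complex_norm_square)
  qed
  ultimately have "(\<Sum>\<nu>\<in>exponents n. (cmod (cf Y \<nu>))\<^sup>2) = 0"
    by (simp only: neg_equal_0_iff_equal of_real_eq_0_iff)
  then have cfY: "cf Y \<nu> = 0" if "\<nu> \<in> exponents n" for \<nu>
    using that by (simp add: sum_nonneg_eq_0_iff finite_exponents)
  then have jet0: "jet_functional N S l (mono3 \<nu>) = 0" if "\<nu> \<in> exponents n" for \<nu>
    using Y_eq[OF that] that by simp
  have l0: "l (v, i, j) = 0" if v: "v \<in> S" and ij: "(i, j) \<in> triangle (N v)" for v i j
  proof (rule jet_functional_separates[where S = S and N = N and K = K and n = n and l = l,
        OF fin nz distinct])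
    show "N w \<le> K" if "w \<in> S" for w
      unfolding K_def using fin that by (simp add: member_le_sum)
    show "K * Suc (card S) \<le> n"
      by (simp add: n_def m_def)
    show "jet_functional N S l G = 0" if "homogeneous n G" for G
      unfolding expand[OF that] by (simp add: jet0)
  qed (use v ij in auto)
  have "Y = 0"
    by (rule poly3_eqI) (use homY cfY in \<open>force simp: homogeneous_def cf_def exponents_def\<close>)
  then have AP: "A * P = B * (- Q)"
    by (simp add: Y_def add_eq_0_iff)
  then have "B dvd A * P" by (simp only: dvd_triv_left)
  then have "B dvd P"
    using cop by (simp add: coprime_dvd_mult_right_iff coprime_commute)
  then have P0: "P = 0"
    by (rule reduced_not_dvd[where n = "n - a"]) (simp add: P_def coef3_sum_mono3[OF finR] split: if_splits
        del: mult_pCons_left)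
  then have Q0: "Q = 0"
    using AP nzB by simp
  have "c \<mu> = 0" if "\<mu> \<in> reduced_exponents B (n - a)" for \<mu>
    using that arg_cong[OF P0, of "\<lambda>G. cf G \<mu>"]
    by (cases \<mu>) (simp add: P_def cf_def coef3_sum_mono3[OF finR] del: mult_pCons_left)
  moreover have "d \<mu> = 0" if "\<mu> \<in> exponents (n - b)" for \<mu>
    using that arg_cong[OF Q0, of "\<lambda>G. cf G \<mu>"]
    by (cases \<mu>) (simp add: Q_def cf_def coef3_sum_mono3[OF finite_exponents] del: mult_pCons_left)
  ultimately have "x u = 0" if "u \<in> U" for u
    using that l0 by (auto simp: U_def J_def c_def d_def l_def)
  with x0 show False by blast
qed

section \<open>A coprime pair of polars\<close>

text \<open>
  The leading exponent of a multiple is the sum of the leading exponents, so it is too large for the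
  smaller degree.
\<close>
lemma homogeneous_dvd_imp_zero:
  assumes "homogeneous a A" "homogeneous b B" "A dvd B" "b < a"
  shows "B = 0"
proof (rule ccontr)
  assume "B \<noteq> 0"
  with assms(3) obtain S where S: "B = A * S" "A \<noteq> 0" "S \<noteq> 0" by auto
  obtain p q r where lA: "lead_exponent A = (p, q, r)" by (cases "lead_exponent A")
  obtain p' q' r' where lS: "lead_exponent S = (p', q', r')" by (cases "lead_exponent S")
  have "p + q + r = a"
    using coef3_lead_exponent[OF lA S(2)] assms(1) by (auto simp: homogeneous_def)
  moreover have "(p + p') + (q + q') + (r + r') = b"
    using coef3_lead_exponent[OF lead_exponent_mult[OF lA lS S(2,3)]] S assms(2)
    by (auto simp: homogeneous_def)
  ultimately show False using assms(4) by simp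
qed

lemma homogeneous_one: "homogeneous 0 1"
  using homogeneous_const3[of 1] by (simp add: one_pCons)

lemma euler_identity:
  assumes "homogeneous d F"
  shows "const3 (of_nat d) * F = X3 * partial_x F + Y3 * partial_y F + Z3 * partial_z F"
proof (rule poly3_eqI)
  fix i j k
  have x: "coef3 (X3 * partial_x F) i j k = of_nat i * coef3 F i j k"
    by (cases i) (simp_all add: coef3_partial_x del: of_nat_Suc)
  have y: "coef3 (Y3 * partial_y F) i j k = of_nat j * coef3 F i j k"
    by (cases j) (simp_all add: coef3_partial_y del: of_nat_Suc)
  have z: "coef3 (Z3 * partial_z F) i j k = of_nat k * coef3 F i j k"
    by (cases k) (simp_all add: coef3_partial_z del: of_nat_Suc)
  have "coef3 (X3 * partial_x F + Y3 * partial_y F + Z3 * partial_z F) i j k =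
      of_nat (i + j + k) * coef3 F i j k"
    by (simp only: coeff_add x y z of_nat_add distrib_right)
  also have "\<dots> = of_nat d * coef3 F i j k"
    using assms by (cases "coef3 F i j k = 0") (auto simp: homogeneous_def simp del: of_nat_add)
  also have "\<dots> = coef3 (const3 (of_nat d) * F) i j k" by simp
  finally show "coef3 (const3 (of_nat d) * F) i j k =
      coef3 (X3 * partial_x F + Y3 * partial_y F + Z3 * partial_z F) i j k" ..
qed

text \<open>
  By Euler's identity a common factor divides \<open>F\<close> and is therefore associated to it; then \<open>F\<close> would
  divide forms of smaller degree, all of which would have to vanish.
\<close>
lemma no_common_factor_of_partials:
  assumes F: "integral_plane_curve d F" and d: "1 \<le> d"
    and h: "\<not> is_unit h" "h dvd partial_x F" "h dvd partial_y F" "h dvd partial_z F"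
  shows False
proof -
  have hom: "homogeneous d F" and irr: "Factorial_Ring.irreducible F"
    using F by (auto simp: integral_plane_curve_def)
  have "h dvd const3 (of_nat d) * F"
    unfolding euler_identity[OF hom] using h by (intro dvd_add dvd_mult)
  then have "h dvd const3 (1 / of_nat d) * (const3 (of_nat d) * F)"
    by (rule dvd_mult)
  also have "const3 (1 / of_nat d) * (const3 (of_nat d) * F) = F"
    using d by (simp add: mult.assoc[symmetric] del: mult.assoc flip: one_pCons)
  finally obtain q where q: "F = h * q" by auto
  then have "is_unit q"
    using irreducibleD[OF irr q] h(1) by blast
  then have "F dvd h"
    unfolding q by (simp add: mult_unit_dvd_iff)
  then have dvd: "F dvd partial_x F" "F dvd partial_y F" "F dvd partial_z F"
    using h dvd_trans by blast+
  have "homogeneous (Suc (d - 1)) F"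
    using hom d by simp
  note hom' = homogeneous_partial[OF this]
  have "partial_x F = 0" "partial_y F = 0" "partial_z F = 0"
    using homogeneous_dvd_imp_zero[OF hom hom'(1) dvd(1)]
      homogeneous_dvd_imp_zero[OF hom hom'(2) dvd(2)]
      homogeneous_dvd_imp_zero[OF hom hom'(3) dvd(3)] d by auto
  then have "const3 (of_nat d) * F = 0"
    unfolding euler_identity[OF hom] by simp
  then show False
    using d irr by (auto simp: irreducible_def)
qed

text \<open>
  The parameter runs through a conic in the net spanned by \<open>f\<close>, \<open>g\<close>, \<open>h\<close>, so any three members span
  the net. A prime factor of \<open>A\<close> that divided three of them would divide \<open>f\<close>, \<open>g\<close> and \<open>h\<close>; hence each
  of the finitely many prime factors of \<open>A\<close> excludes at most two parameters.
\<close>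
lemma coprime_net_member:
  fixes f g h A :: poly3
  assumes A: "A \<noteq> 0"
    and gcd1: "\<And>q. \<not> is_unit q \<Longrightarrow> q dvd f \<Longrightarrow> q dvd g \<Longrightarrow> q dvd h \<Longrightarrow> False"
  shows "\<exists>c. coprime A (f + const3 c * g + const3 (c\<^sup>2) * h)"
proof -
  let ?B = "\<lambda>c. f + const3 c * g + const3 (c\<^sup>2) * h"
  define bad where "bad q = {c. q dvd ?B c}" for q
  have scale: "q dvd w" if "q dvd const3 e * w" "e \<noteq> 0" for q w :: poly3 and e
  proof -
    have "q dvd const3 (1 / e) * (const3 e * w)"
      using that(1) by (rule dvd_mult)
    also have "const3 (1 / e) * (const3 e * w) = w"
      using that(2) by (simp flip: one_pCons)
    finally show ?thesis .
  qed
  have fin: "finite (bad q)" if q: "q \<in> prime_factors A" for q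
  proof (rule ccontr)
    assume "infinite (bad q)"
    then obtain C where "finite C" "card C = 3" "C \<subseteq> bad q"
      using infinite_arbitrarily_large by blast
    then obtain x y z where xyz: "x \<in> bad q" "y \<in> bad q" "z \<in> bad q" "x \<noteq> y" "y \<noteq> z" "x \<noteq> z"
      by (auto simp: card_3_iff)
    have diff: "q dvd g + const3 (x + y) * h" if "x \<in> bad q" "y \<in> bad q" "x \<noteq> y" for x y
    proof -
      have "q dvd ?B x - ?B y"
        using that by (intro dvd_diff) (simp_all only: bad_def mem_Collect_eq)
      also have "?B x - ?B y = const3 (x - y) * (g + const3 (x + y) * h)"
        by (rule poly3_eqI) (simp add: algebra_simps power2_eq_square)
      finally show ?thesis
        using that scale by (metis right_minus_eq)
    qed
    have "q dvd (g + const3 (x + y) * h) - (g + const3 (x + z) * h)"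
      using diff xyz by (intro dvd_diff) auto
    also have "(g + const3 (x + y) * h) - (g + const3 (x + z) * h) = const3 (y - z) * h"
      by (rule poly3_eqI) (simp add: algebra_simps)
    finally have qh: "q dvd h"
      using xyz scale by (metis right_minus_eq)
    have qg: "q dvd g"
      using diff[OF xyz(1,2,4)] dvd_mult[OF qh, of "const3 (x + y)"] by (metis dvd_add_left_iff)
    have "q dvd ?B x" using xyz(1) by (simp only: bad_def mem_Collect_eq)
    then have qf: "q dvd f"
      using dvd_mult[OF qh, of "const3 (x\<^sup>2)"] dvd_mult[OF qg, of "const3 x"]
      by (metis dvd_add_left_iff)
    have "\<not> is_unit q"
      using in_prime_factors_imp_prime[OF q] not_prime_unit by blast
    then show False
      using gcd1 qf qg qh by blast
  qed
  then have "finite (\<Union>q\<in>prime_factors A. bad q)" by simp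
  then obtain c where c: "c \<notin> (\<Union>q\<in>prime_factors A. bad q)"
    using infinite_UNIV_char_0 by (metis UNIV_eq_I)
  have "coprime A (?B c)"
  proof (rule ccontr)
    assume "\<not> coprime A (?B c)"
    then have "\<not> is_unit (gcd A (?B c))"
      by (simp only: is_unit_gcd not_False_eq_True)
    moreover have "gcd A (?B c) \<noteq> 0"
      using A by simp
    ultimately obtain q where q: "q dvd gcd A (?B c)" and prime: "normalization_semidom_class.prime q"
      using prime_divisor_exists[of "gcd A (?B c)"] by blast
    have "q dvd A" "q dvd ?B c"
      by (rule dvd_trans[OF q gcd_dvd1], rule dvd_trans[OF q gcd_dvd2])
    then have "q \<in> prime_factors A" "c \<in> bad q"
      using A prime by (auto simp only: in_prime_factors_iff bad_def mem_Collect_eq)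
    with c show False by blast
  qed
  then show ?thesis by (rule exI)
qed

lemma vanishes_to_order_partial:
  assumes "vanishes_to_order m v F"
  shows "vanishes_to_order (m - 1) v (partial_x F)" "vanishes_to_order (m - 1) v (partial_y F)"
    "vanishes_to_order (m - 1) v (partial_z F)"
  using assms by (cases m; simp)+

lemma polar_inequality:
  assumes F: "integral_plane_curve d F" and d: "2 \<le> d"
    and S: "finite S" "0 \<notin> S" "\<And>v w t. v \<in> S \<Longrightarrow> w \<in> S \<Longrightarrow> v = t *s w \<Longrightarrow> v = w"
    and m: "\<And>v. v \<in> S \<Longrightarrow> vanishes_to_order (m v) v F"
  shows "(\<Sum>v\<in>S. (m v - 1)\<^sup>2) \<le> (d - 1)\<^sup>2"
proof -
  have gcd1: False if "\<not> is_unit q" "q dvd partial_x F" "q dvd partial_y F" "q dvd partial_z F" for q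
    using no_common_factor_of_partials[OF F] that d by simp
  have "homogeneous (Suc (d - 1)) F"
    using F d by (simp add: integral_plane_curve_def)
  note hom = homogeneous_partial[OF this]
  have "\<exists>A\<in>{partial_x F, partial_y F, partial_z F}. A \<noteq> 0"
  proof (rule ccontr)
    assume "\<not> ?thesis"
    then have "Z3 dvd partial_x F" "Z3 dvd partial_y F" "Z3 dvd partial_z F"
      by simp_all
    moreover have "\<not> is_unit Z3"
      using homogeneous_dvd_imp_zero[OF homogeneous_Z3 homogeneous_one] by auto
    ultimately show False using gcd1 by blast
  qed
  then obtain A where A: "A \<in> {partial_x F, partial_y F, partial_z F}" "A \<noteq> 0" by blast
  have "\<exists>c. coprime A (partial_x F + const3 c * partial_y F + const3 (c\<^sup>2) * partial_z F)"
    by (rule coprime_net_member[OF A(2)]) (rule gcd1)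
  then obtain c where cop: "coprime A (partial_x F + const3 c * partial_y F + const3 (c\<^sup>2) * partial_z F)"
    (is "coprime A ?B") ..
  have homA: "homogeneous (d - 1) A"
    using A(1) hom by (elim insertE emptyE) simp_all
  have homB: "homogeneous (d - 1) ?B"
    by (intro homogeneous_add homogeneous_const3_mult hom)
  have "\<not> is_unit A"
    using homogeneous_dvd_imp_zero[OF homA homogeneous_one] d by auto
  then have "?B \<noteq> 0"
    using cop coprime_0_right_iff[of A] by (cases "?B = 0") simp_all
  have ordA: "order_ge (m v - 1) (local_exp v A)" if "v \<in> S" for v
    by (rule vanishes_to_order_local_exp)
      (use A(1) vanishes_to_order_partial[OF m[OF that]] in \<open>elim insertE emptyE; simp\<close>)
  have ordB: "order_ge (m v - 1) (local_exp v ?B)" if "v \<in> S" for v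
    by (intro vanishes_to_order_local_exp vanishes_to_order_add vanishes_to_order_const3_mult
        vanishes_to_order_partial m that)
  have "(\<Sum>v\<in>S. (m v - 1) * (m v - 1)) \<le> (d - 1) * (d - 1)"
    using bezout_inequality[OF homA homB A(2) \<open>?B \<noteq> 0\<close> cop S ordA ordB] .
  then show ?thesis
    by (simp only: power2_eq_square)
qed

section \<open>The function field\<close>

text \<open>
  The residue field of the local ring of the plane at the generic point of the curve. Inside the
  field of fractions of the polynomial ring one can calculate with type-class arithmetic; the
  projection \<open>\<pi>\<close> to the residue field is applied only to the results.
\<close>
locale integral_curve =
  fixes F :: poly3 and d :: nat
  assumes curve: "integral_plane_curve d F"
begin

lemma homogeneous_F: "homogeneous d F"
  using curve by (simp add: integral_plane_curve_def)

lemma prime_F: "prime_elem F"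
  using curve by (simp add: integral_plane_curve_def irreducible_imp_prime_elem)

lemma F_nonzero: "F \<noteq> 0"
  using prime_F by auto

lemma F_not_dvd: "homogeneous n G \<Longrightarrow> n < d \<Longrightarrow> G \<noteq> 0 \<Longrightarrow> \<not> F dvd G"
  using homogeneous_dvd_imp_zero[OF homogeneous_F] by blast

lemma degree_pos: "0 < d"
proof (rule ccontr)
  assume "\<not> 0 < d"
  then obtain c where c: "F = const3 c"
    using homogeneous_0_imp_const3 homogeneous_F by auto
  then have "F * const3 (1 / c) = 1"
    using F_nonzero by (simp flip: one_pCons)
  then have "is_unit F"
    by (metis dvdI)
  then show False
    using prime_F by auto
qed

lemma F_not_dvd_mult: "\<not> F dvd G \<Longrightarrow> \<not> F dvd H \<Longrightarrow> \<not> F dvd G * H"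
  using prime_elem_dvd_mult_iff[OF prime_F] by blast

lemma F_not_dvd_power: "\<not> F dvd G \<Longrightarrow> \<not> F dvd G ^ n"
  using prime_elem_dvd_power[OF prime_F] by blast

abbreviation R :: "poly3 fract ring" where "R \<equiv> curve_local_ring F"
abbreviation M :: "poly3 fract set" where "M \<equiv> curve_max_ideal F"
abbreviation K :: "poly3 fract set ring" where "K \<equiv> function_field F"
abbreviation \<pi> :: "poly3 fract \<Rightarrow> poly3 fract set" where "\<pi> x \<equiv> M +>\<^bsub>R\<^esub> x"

lemma ops_R: "x \<oplus>\<^bsub>R\<^esub> y = x + y" "x \<otimes>\<^bsub>R\<^esub> y = x * y" "\<zero>\<^bsub>R\<^esub> = 0" "\<one>\<^bsub>R\<^esub> = 1"
  by (simp_all add: curve_local_ring_def ring_of_type_algebra_def)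

lemma carrier_R_iff: "x \<in> carrier R \<longleftrightarrow>
    (\<exists>G H n. x = Fract G H \<and> homogeneous n G \<and> homogeneous n H \<and> \<not> F dvd H)"
  by (auto simp: curve_local_ring_def)

lemma carrier_R_E:
  assumes "x \<in> carrier R"
  obtains G H n where "x = Fract G H" "homogeneous n G" "homogeneous n H" "\<not> F dvd H" "H \<noteq> 0"
  using assms unfolding carrier_R_iff by (metis dvd_0_right)

lemma Fract_in_R: "homogeneous n G \<Longrightarrow> homogeneous n H \<Longrightarrow> \<not> F dvd H \<Longrightarrow> Fract G H \<in> carrier R"
  unfolding carrier_R_iff by blast

lemma Fract_in_M_iff:
  assumes "homogeneous n G" "homogeneous n H" "\<not> F dvd H"
  shows "Fract G H \<in> M \<longleftrightarrow> F dvd G"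
proof
  assume "Fract G H \<in> M"
  then obtain G' H' where *: "Fract G H = Fract G' H'" "\<not> F dvd H'" "F dvd G'"
    by (auto simp: curve_max_ideal_def)
  then have "H \<noteq> 0" "H' \<noteq> 0"
    using assms by auto
  then have "G * H' = G' * H"
    using * by (simp add: eq_fract)
  then have "F dvd G * H'"
    using * by simp
  then show "F dvd G"
    using prime_elem_dvd_mult_iff[OF prime_F] *(2) by blast
next
  assume "F dvd G"
  then show "Fract G H \<in> M"
    using assms by (auto simp: curve_max_ideal_def)
qed

lemma M_subset: "M \<subseteq> carrier R"
  unfolding curve_max_ideal_def subset_iff mem_Collect_eq carrier_R_iff by blast

lemma R_add: assumes "x \<in> carrier R" "y \<in> carrier R" shows "x + y \<in> carrier R"
proof -
  obtain G H n where x: "x = Fract G H" "homogeneous n G" "homogeneous n H" "\<not> F dvd H" "H \<noteq> 0"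
    using assms(1) by (rule carrier_R_E)
  obtain G' H' n' where y: "y = Fract G' H'" "homogeneous n' G'" "homogeneous n' H'" "\<not> F dvd H'" "H' \<noteq> 0"
    using assms(2) by (rule carrier_R_E)
  have "x + y = Fract (G * H' + G' * H) (H * H')"
    using x y by simp
  moreover have "homogeneous (n + n') (G * H' + G' * H)"
    using homogeneous_mult[OF x(2) y(3)] homogeneous_mult[OF y(2) x(3)]
    by (simp add: homogeneous_add add.commute)
  ultimately show ?thesis
    using Fract_in_R homogeneous_mult[OF x(3) y(3)] F_not_dvd_mult[OF x(4) y(4)] by metis
qed

lemma R_mult: assumes "x \<in> carrier R" "y \<in> carrier R" shows "x * y \<in> carrier R"
proof -
  obtain G H n where x: "x = Fract G H" "homogeneous n G" "homogeneous n H" "\<not> F dvd H" "H \<noteq> 0"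
    using assms(1) by (rule carrier_R_E)
  obtain G' H' n' where y: "y = Fract G' H'" "homogeneous n' G'" "homogeneous n' H'" "\<not> F dvd H'" "H' \<noteq> 0"
    using assms(2) by (rule carrier_R_E)
  have "x * y = Fract (G * G') (H * H')"
    using x y by simp
  then show ?thesis
    using Fract_in_R homogeneous_mult[OF x(2) y(2)] homogeneous_mult[OF x(3) y(3)]
      F_not_dvd_mult[OF x(4) y(4)] by metis
qed

definition \<kappa> :: "complex \<Rightarrow> poly3 fract" where "\<kappa> c = Fract (const3 c) 1"
definition \<iota> :: "poly3 \<Rightarrow> poly3 fract" where "\<iota> G = Fract G 1"

lemma unital_hom_\<iota>: "unital_hom \<iota>"
  by standard (simp_all add: \<iota>_def One_fract_def)

lemma unital_hom_\<kappa>: "unital_hom \<kappa>"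
  using unital_hom_comp[OF unital_hom_\<iota> unital_hom_const3] by (simp add: \<kappa>_def[abs_def] \<iota>_def)

lemma R_const: "\<kappa> c \<in> carrier R"
  unfolding \<kappa>_def using homogeneous_const3 homogeneous_one F_not_dvd[OF homogeneous_one degree_pos]
  by (intro Fract_in_R) auto

lemma const_notin_M: "c \<noteq> 0 \<Longrightarrow> \<kappa> c \<notin> M"
  using Fract_in_M_iff[OF homogeneous_const3 homogeneous_one]
    F_not_dvd[OF homogeneous_one degree_pos] F_not_dvd[OF homogeneous_const3 degree_pos]
  by (simp add: \<kappa>_def)

lemma R_zero: "0 \<in> carrier R" and R_one: "1 \<in> carrier R"
  using R_const[of 0] R_const[of 1] unital_hom.hom_zero[OF unital_hom_\<kappa>]
    unital_hom.hom_one[OF unital_hom_\<kappa>] by simp_all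

lemma R_uminus: "x \<in> carrier R \<Longrightarrow> - x \<in> carrier R"
  using R_mult[OF R_const[of "- 1"], of x] unital_hom.hom_uminus[OF unital_hom_\<kappa>, of 1]
    unital_hom.hom_one[OF unital_hom_\<kappa>] by simp

lemma M_zero: "0 \<in> M"
  using Fract_in_M_iff[OF homogeneous_0 homogeneous_one] F_not_dvd[OF homogeneous_one degree_pos]
  by (simp add: fract_collapse)

lemma M_add: assumes "x \<in> M" "y \<in> M" shows "x + y \<in> M"
proof -
  obtain G H n where x: "x = Fract G H" "homogeneous n G" "homogeneous n H" "\<not> F dvd H" "F dvd G"
    using assms(1) by (auto simp: curve_max_ideal_def)
  obtain G' H' n' where y: "y = Fract G' H'" "homogeneous n' G'" "homogeneous n' H'" "\<not> F dvd H'" "F dvd G'"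
    using assms(2) by (auto simp: curve_max_ideal_def)
  have "H \<noteq> 0" "H' \<noteq> 0"
    using x y by auto
  then have "x + y = Fract (G * H' + G' * H) (H * H')"
    using x y by simp
  moreover have "homogeneous (n + n') (G * H' + G' * H)"
    using homogeneous_mult[OF x(2) y(3)] homogeneous_mult[OF y(2) x(3)]
    by (simp add: homogeneous_add add.commute)
  moreover have "F dvd G * H' + G' * H"
    using x y by simp
  ultimately show ?thesis
    using Fract_in_M_iff homogeneous_mult[OF x(3) y(3)] F_not_dvd_mult[OF x(4) y(4)] by metis
qed

lemma M_mult: assumes "x \<in> M" "y \<in> carrier R" shows "x * y \<in> M"
proof -
  obtain G H n where x: "x = Fract G H" "homogeneous n G" "homogeneous n H" "\<not> F dvd H" "F dvd G"
    using assms(1) by (auto simp: curve_max_ideal_def)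
  obtain G' H' n' where y: "y = Fract G' H'" "homogeneous n' G'" "homogeneous n' H'" "\<not> F dvd H'" "H' \<noteq> 0"
    using assms(2) by (rule carrier_R_E)
  have "x * y = Fract (G * G') (H * H')" "F dvd G * G'"
    using x y by simp_all
  then show ?thesis
    using Fract_in_M_iff homogeneous_mult[OF x(2) y(2)] homogeneous_mult[OF x(3) y(3)]
      F_not_dvd_mult[OF x(4) y(4)] by metis
qed

lemma one_notin_M: "1 \<notin> M"
  using const_notin_M[of 1] unital_hom.hom_one[OF unital_hom_\<kappa>] by simp

lemma R_inverse:
  assumes "x \<in> carrier R" "x \<notin> M"
  shows "inverse x \<in> carrier R" "x * inverse x = 1"
proof -
  obtain G H n where x: "x = Fract G H" "homogeneous n G" "homogeneous n H" "\<not> F dvd H" "H \<noteq> 0"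
    using assms(1) by (rule carrier_R_E)
  have "\<not> F dvd G"
    using assms(2) x Fract_in_M_iff by blast
  then show "inverse x \<in> carrier R"
    using x Fract_in_R by simp
  have "x \<noteq> 0"
    using assms(2) M_zero by blast
  then show "x * inverse x = 1" by simp
qed

lemma M_prime: "x \<in> carrier R \<Longrightarrow> y \<in> carrier R \<Longrightarrow> x * y \<in> M \<Longrightarrow> x \<notin> M \<Longrightarrow> y \<in> M"
  using M_mult[of "x * y" "inverse x"] R_inverse[of x] by (metis mult.assoc mult.commute mult_1_right)

lemma R_poly: "x \<in> carrier R \<Longrightarrow> poly (map_poly \<kappa> p) x \<in> carrier R"
  by (induction p)
    (auto simp: unital_hom.poly_map_poly_pCons[OF unital_hom_\<kappa>] R_zero intro: R_add R_mult R_const)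

lemma R_power: "x \<in> carrier R \<Longrightarrow> x ^ n \<in> carrier R"
  by (induction n) (auto simp: R_one R_mult)

lemma R_sum: "(\<And>i. i \<in> A \<Longrightarrow> f i \<in> carrier R) \<Longrightarrow> sum f A \<in> carrier R"
  by (induction A rule: infinite_finite_induct) (auto simp: R_zero R_add)

lemma cring_R: "cring R"
proof (rule cringI)
  show "abelian_group R"
  proof (rule abelian_groupI)
    show "\<exists>y\<in>carrier R. y \<oplus>\<^bsub>R\<^esub> x = \<zero>\<^bsub>R\<^esub>" if "x \<in> carrier R" for x
      using R_uminus[OF that] by (intro bexI[of _ "- x"]) (auto simp: ops_R)
  qed (auto simp: ops_R R_add R_zero)
  show "comm_monoid R"
    by (rule comm_monoidI) (auto simp: ops_R R_mult R_one)
qed (auto simp: ops_R algebra_simps)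

sublocale R: cring R
  by (rule cring_R)

lemma ideal_M: "ideal M R"
proof (rule idealI)
  show "ring R" by (rule R.ring_axioms)
  show "subgroup M (add_monoid R)"
  proof (rule R.add.subgroupI)
    show "M \<subseteq> carrier R" by (rule M_subset)
    show "M \<noteq> {}" using M_zero by blast
    show "\<ominus>\<^bsub>R\<^esub> x \<in> M" if "x \<in> M" for x
    proof -
      have x: "x \<in> carrier R"
        using that M_subset by blast
      then have "\<ominus>\<^bsub>R\<^esub> x = - x"
        by (intro R.minus_equality) (auto simp: ops_R R_uminus)
      moreover have "- x = x * (- 1)" by simp
      ultimately show ?thesis
        using M_mult[OF that R_uminus[OF R_one]] by metis
    qed
  qed (auto simp: ops_R M_add)
qed (auto simp: ops_R M_mult mult.commute)

lemma maximalideal_M: "maximalideal M R"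
proof (rule maximalidealI)
  show "carrier R \<noteq> M"
    using one_notin_M R_one by blast
  fix J
  assume J: "ideal J R" "M \<subseteq> J" "J \<subseteq> carrier R"
  interpret J: ideal J R by fact
  have "J = carrier R" if "x \<in> J" "x \<notin> M" for x
  proof (rule J.one_imp_carrier)
    have "x \<otimes>\<^bsub>R\<^esub> inverse x \<in> J"
      using that R_inverse J by (intro J.I_r_closed) auto
    then show "\<one>\<^bsub>R\<^esub> \<in> J"
      using that J(3) R_inverse(2)[of x] by (auto simp: ops_R)
  qed
  then show "J = M \<or> J = carrier R"
    using J(2) by blast
qed (rule ideal_M)

lemma zero_K: "\<zero>\<^bsub>K\<^esub> = M"
  by (simp only: function_field_def FactRing_def ring.simps)

lemma carrier_K: "carrier K = \<pi> ` carrier R"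
  by (auto simp: function_field_def FactRing_def A_RCOSETS_def')

sublocale K: field K
  unfolding function_field_def by (rule maximalideal.quotient_is_field[OF maximalideal_M cring_R])

sublocale \<pi>: ring_hom_ring R K \<pi>
  unfolding function_field_def by (rule ideal.rcos_ring_hom_ring[OF ideal_M])

lemma \<pi>_eq_zero_iff: "x \<in> carrier R \<Longrightarrow> \<pi> x = \<zero>\<^bsub>K\<^esub> \<longleftrightarrow> x \<in> M"
proof -
  interpret M: ideal M R by (rule ideal_M)
  assume x: "x \<in> carrier R"
  show ?thesis
    unfolding zero_K using M.rcos_const_imp_mem[OF x] M.a_rcos_const[of x] by blast
qed

lemma \<pi>_add: "x \<in> carrier R \<Longrightarrow> y \<in> carrier R \<Longrightarrow> \<pi> (x + y) = \<pi> x \<oplus>\<^bsub>K\<^esub> \<pi> y"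
  and \<pi>_mult: "x \<in> carrier R \<Longrightarrow> y \<in> carrier R \<Longrightarrow> \<pi> (x * y) = \<pi> x \<otimes>\<^bsub>K\<^esub> \<pi> y"
  and \<pi>_one: "\<pi> 1 = \<one>\<^bsub>K\<^esub>" and \<pi>_zero: "\<pi> 0 = \<zero>\<^bsub>K\<^esub>"
  using \<pi>.hom_add \<pi>.hom_mult \<pi>.hom_one \<pi>.hom_zero by (simp_all only: ops_R)

lemma \<pi>_carrier: "x \<in> carrier R \<Longrightarrow> \<pi> x \<in> carrier K"
  by (rule \<pi>.hom_closed)

lemma \<pi>_power: "x \<in> carrier R \<Longrightarrow> \<pi> (x ^ n) = \<pi> x [^]\<^bsub>K\<^esub> n"
  by (induction n) (simp_all add: \<pi>_one \<pi>_mult R_power \<pi>_carrier K.m_comm)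

lemma function_field_constants_eq: "function_field_constants F = range (\<lambda>c. \<pi> (\<kappa> c))"
  by (simp add: function_field_constants_def \<kappa>_def)

section \<open>Projection from a point\<close>

text \<open>
  Over the algebraically closed constants a polynomial splits into linear factors, none of which
  vanishes at a nonconstant function; and the maximal ideal is prime.
\<close>
lemma nonconstant_is_transcendental:
  assumes x: "x \<in> carrier R" and nonconst: "\<And>c. x - \<kappa> c \<notin> M" and p: "p \<noteq> 0"
  shows "poly (map_poly \<kappa> p) x \<notin> M"
  using p
proof (induction "Polynomial.degree p" arbitrary: p)
  case 0
  then obtain c where "p = [:c:]" "c \<noteq> 0"
    by (metis degree_eq_zeroE pCons_0_0)
  then show ?case
    using const_notin_M by (simp add: map_poly_pCons unital_hom.hom_zero[OF unital_hom_\<kappa>])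
next
  case (Suc n)
  interpret E: unital_hom "\<lambda>p. poly (map_poly \<kappa> p) x"
    by (rule unital_hom.unital_hom_poly_map_poly[OF unital_hom_\<kappa>])
  have "\<not> constant (poly p)"
    using Suc.hyps(2) by (simp add: constant_degree)
  then obtain a where "poly p a = 0"
    using fundamental_theorem_of_algebra by blast
  then obtain q where q: "p = [:- a, 1:] * q"
    by (metis poly_eq_0_iff_dvd dvdE)
  then have q0: "q \<noteq> 0" using Suc.prems by auto
  then have "n = Polynomial.degree q"
    using Suc.hyps(2) degree_mult_eq[of "[:- a, 1:]" q] unfolding q by (simp del: mult_pCons_left)
  then have "poly (map_poly \<kappa> q) x \<notin> M"
    using Suc.hyps(1) q0 by blast
  moreover have "poly (map_poly \<kappa> [:- a, 1:]) x = x - \<kappa> a"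
    by (simp add: map_poly_pCons unital_hom.hom_zero[OF unital_hom_\<kappa>]
        unital_hom.hom_one[OF unital_hom_\<kappa>] unital_hom.hom_uminus[OF unital_hom_\<kappa>])
  ultimately show ?case
    unfolding q E.hom_mult
    using M_prime[of "x - \<kappa> a" "poly (map_poly \<kappa> q) x"] nonconst R_poly[OF x]
    by (metis R_poly x)
qed

text \<open>
  Polynomials over the function field are lists that start with the leading coefficient, which is
  why the exponents are enumerated backwards.
\<close>
lemma eval_image:
  assumes "t \<in> carrier R" "\<And>j. g j \<in> carrier R"
  shows "K.eval (map (\<lambda>j. \<pi> (g j)) (rev [0..<n])) (\<pi> t) = \<pi> (\<Sum>j<n. g j * t ^ j)"
proof (induction n)
  case (Suc n)
  have "(\<Sum>j<n. g j * t ^ j) \<in> carrier R"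
    by (intro R_sum R_mult R_power assms)
  then show ?case
    using Suc assms by (simp add: \<pi>_add \<pi>_mult \<pi>_power R_mult R_power \<pi>_carrier K.a_comm)
qed (simp add: \<pi>_zero)

lemma poly_map_poly_closed:
  assumes "h 0 = 0" "\<And>a. h a \<in> C" "x \<in> C" "0 \<in> C"
    "\<And>a b. a \<in> C \<Longrightarrow> b \<in> C \<Longrightarrow> a + b \<in> C" "\<And>a b. a \<in> C \<Longrightarrow> b \<in> C \<Longrightarrow> a * b \<in> C"
  shows "poly (map_poly h p) x \<in> C"
  by (induction p) (simp_all add: map_poly_pCons assms)

text \<open>
  A form is the homogenization of its Taylor expansion. The coordinates themselves satisfy the
  equation because they are combinations of the frame, and substitution into a form is compatible
  with both sides, the denominator \<open>W\<close> contributing its \<open>n\<close>-th power by homogeneity.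
\<close>

lemma subst2_local_exp:
  assumes frame: "local_exp v U = S2" "local_exp v V = T2" "local_exp v W = 1"
    "\<And>H. H \<in> {X3, Y3, Z3} \<Longrightarrow> \<exists>c a b. H = const3 c * W + const3 a * U + const3 b * V"
    and W: "W \<noteq> 0" and G: "homogeneous n G"
  shows "subst2 \<kappa> (local_exp v G) (\<iota> U / \<iota> W) (\<iota> V / \<iota> W) = \<iota> G / \<iota> W ^ n"
proof -
  interpret \<iota>: unital_hom \<iota> by (rule unital_hom_\<iota>)
  let ?E = "\<lambda>g. subst2 \<kappa> g (\<iota> U / \<iota> W) (\<iota> V / \<iota> W)"
  interpret E: unital_hom ?E
    by (rule unital_hom_subst2[OF unital_hom_\<kappa>])
  have W0: "\<iota> W \<noteq> 0"
    using W by (simp add: \<iota>_def Zero_fract_def eq_fract)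
  have coord: "?E (local_exp v H) = 1 / \<iota> W * \<iota> H" if H: "H \<in> {X3, Y3, Z3}" for H
  proof -
    obtain c a b where *: "H = const3 c * W + const3 a * U + const3 b * V"
      using frame(4)[OF H] by blast
    have "?E (local_exp v H) = \<kappa> c + \<kappa> a * (\<iota> U / \<iota> W) + \<kappa> b * (\<iota> V / \<iota> W)"
      by (simp only: * local_exp.hom_add local_exp.hom_mult local_exp_const3 frame E.hom_add E.hom_mult
          E.hom_one subst2_const2[OF unital_hom_\<kappa>] subst2_S2[OF unital_hom_\<kappa>]
          subst2_T2[OF unital_hom_\<kappa>] mult_1_right)
    moreover have "\<iota> H = \<kappa> c * \<iota> W + \<kappa> a * \<iota> U + \<kappa> b * \<iota> V"
      unfolding * by (simp only: \<iota>.hom_add \<iota>.hom_mult) (simp add: \<iota>_def \<kappa>_def)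
    ultimately show ?thesis
      using W0 by (simp add: field_simps)
  qed
  have "?E (local_exp v G) =
      subst3 \<kappa> G (?E (local_exp v X3)) (?E (local_exp v Y3)) (?E (local_exp v Z3))"
    by (subst local_exp_eq_subst3, subst hom_subst3[OF E.unital_hom_axioms unital_hom_const2])
      (simp only: subst2_const2[OF unital_hom_\<kappa>])
  also have "\<dots> = subst3 \<kappa> G (1 / \<iota> W * \<iota> X3) (1 / \<iota> W * \<iota> Y3) (1 / \<iota> W * \<iota> Z3)"
    by (simp only: coord insert_iff simp_thms)
  also have "\<dots> = (1 / \<iota> W) ^ n * subst3 \<kappa> G (\<iota> X3) (\<iota> Y3) (\<iota> Z3)"
    by (rule subst3_scale[OF unital_hom_\<kappa> G])
  also have "subst3 \<kappa> G (\<iota> X3) (\<iota> Y3) (\<iota> Z3) = \<iota> (subst3 const3 G X3 Y3 Z3)"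
    by (subst hom_subst3[OF unital_hom_\<iota> unital_hom_const3]) (simp add: \<iota>_def \<kappa>_def[abs_def])
  also have "\<dots> = \<iota> G"
    by (simp only: subst3_identity)
  finally show ?thesis
    by (simp add: power_divide)
qed

text \<open>
  On the line of the points $(at, t)$ a polynomial becomes a polynomial in \<open>t\<close>, whose \<open>k\<close>-th
  coefficient collects the terms of total degree \<open>k\<close>.
\<close>
lemma subst2_expand:
  assumes f: "\<And>i j. N < i + j \<Longrightarrow> coef2 f i j = 0"
  shows "subst2 \<kappa> f (a * t) t =
    (\<Sum>k<Suc N. poly (map_poly \<kappa> (\<Sum>i\<le>k. monom (coef2 f i (k - i)) i)) a * t ^ k)"
proof -
  interpret E: unital_hom "\<lambda>f. subst2 \<kappa> f (a * t) t"
    by (rule unital_hom_subst2[OF unital_hom_\<kappa>])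
  interpret E1: unital_hom "\<lambda>p. poly (map_poly \<kappa> p) a"
    by (rule unital_hom.unital_hom_poly_map_poly[OF unital_hom_\<kappa>])
  have f_eq: "f = (\<Sum>(i, j)\<in>triangle (Suc N). const2 (coef2 f i j) * (S2 ^ i * T2 ^ j))"
  proof (intro poly_eqI)
    fix p q
    have "coef2 (\<Sum>(i, j)\<in>triangle (Suc N). const2 (coef2 f i j) * (S2 ^ i * T2 ^ j)) q p =
        (\<Sum>\<mu>\<in>triangle (Suc N). if \<mu> = (q, p) then coef2 f q p else 0)"
      unfolding coeff_sum
    proof (rule sum.cong[OF refl])
      fix \<mu> :: "nat \<times> nat"
      obtain i j where \<mu>: "\<mu> = (i, j)" by (cases \<mu>)
      show "coef2 (case \<mu> of (i, j) \<Rightarrow> const2 (coef2 f i j) * (S2 ^ i * T2 ^ j)) q p =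
          (if \<mu> = (q, p) then coef2 f q p else 0)"
        using coef2_S2_T2_mult[where a = i and b = j and f = 1 and i = q and j = p]
        by (auto simp: \<mu> coeff_1 split: if_splits)
    qed
    also have "\<dots> = coef2 f q p"
      using f[of q p] by (simp add: finite_triangle) (auto simp: triangle_def)
    finally show "coef2 f q p =
        coef2 (\<Sum>(i, j)\<in>triangle (Suc N). const2 (coef2 f i j) * (S2 ^ i * T2 ^ j)) q p" ..
  qed
  have monom: "poly (map_poly \<kappa> (monom c i)) a = \<kappa> c * a ^ i" for c i
    by (simp add: map_poly_monom unital_hom.hom_zero[OF unital_hom_\<kappa>] poly_monom)
  have "subst2 \<kappa> f (a * t) t = (\<Sum>(i, j)\<in>triangle (Suc N). \<kappa> (coef2 f i j) * ((a * t) ^ i * t ^ j))"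
    by (subst f_eq) (simp only: case_prod_unfold E.hom_sum E.hom_mult E.hom_power
        subst2_const2[OF unital_hom_\<kappa>] subst2_S2[OF unital_hom_\<kappa>] subst2_T2[OF unital_hom_\<kappa>])
  also have "\<dots> = (\<Sum>k<Suc N. \<Sum>i\<le>k. \<kappa> (coef2 f i (k - i)) * ((a * t) ^ i * t ^ (k - i)))"
    unfolding triangle_def by (rule sum.triangle_reindex)
  also have "\<dots> = (\<Sum>k<Suc N. poly (map_poly \<kappa> (\<Sum>i\<le>k. monom (coef2 f i (k - i)) i)) a * t ^ k)"
  proof (rule sum.cong[OF refl])
    fix k
    have summand: "\<kappa> (coef2 f i (k - i)) * ((a * t) ^ i * t ^ (k - i)) = \<kappa> (coef2 f i (k - i)) * a ^ i * t ^ k"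
      if "i \<le> k" for i
    proof -
      have "t ^ i * t ^ (k - i) = t ^ k"
        using that by (simp flip: power_add)
      then show ?thesis
        by (metis (no_types, lifting) mult.assoc power_mult_distrib)
    qed
    show "(\<Sum>i\<le>k. \<kappa> (coef2 f i (k - i)) * ((a * t) ^ i * t ^ (k - i))) =
        poly (map_poly \<kappa> (\<Sum>i\<le>k. monom (coef2 f i (k - i)) i)) a * t ^ k"
      unfolding E1.hom_sum monom sum_distrib_right by (intro sum.cong refl summand) simp
  qed
  finally show ?thesis .
qed

text \<open>
  The projection from the point \<open>v\<close> is the function $\varphi = U/V$. The affine coordinates at \<open>v\<close> are
  $U/W = \varphi t$ and $V/W = t$, so $\varphi$ and \<open>t\<close> generate the function field over the
  constants. The equation of the curve becomes $\sum_k c_k(\varphi) t^k = 0$ with $m \le k \le d$; it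
  is nontrivial because $\varphi$ is transcendental over the constants. Division by $t^m$ leaves an equation of
  degree at most $d - m$ for \<open>t\<close> over the field generated by $\varphi$.
\<close>
lemma gonality_projection:
  assumes d: "2 \<le> d" and v: "v \<noteq> 0" and ord: "order_ge m (local_exp v F)"
  shows "gonality F + m \<le> d"
proof -
  interpret \<kappa>: unital_hom \<kappa> by (rule unital_hom_\<kappa>)
  interpret \<iota>: unital_hom \<iota> by (rule unital_hom_\<iota>)
  obtain U V W where hom: "homogeneous 1 U" "homogeneous 1 V" "homogeneous 1 W"
    and frame: "local_exp v U = S2" "local_exp v V = T2" "local_exp v W = 1"
      "\<And>H. H \<in> {X3, Y3, Z3} \<Longrightarrow> \<exists>c a b. H = const3 c * W + const3 a * U + const3 b * V"
    using local_frame[OF v] by metis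
  have V0: "V \<noteq> 0" and W0: "W \<noteq> 0"
    using frame by (auto simp: local_exp.hom_zero)
  have V: "\<not> F dvd V" and W: "\<not> F dvd W"
    using F_not_dvd[OF hom(2)] F_not_dvd[OF hom(3)] V0 W0 d by auto
  define \<phi> where "\<phi> = Fract U V"
  define t where "t = Fract V W"
  have \<phi>R: "\<phi> \<in> carrier R" and tR: "t \<in> carrier R"
    unfolding \<phi>_def t_def using hom V W by (auto intro: Fract_in_R)
  have tM: "t \<notin> M"
    unfolding t_def using Fract_in_M_iff[OF hom(2,3) W] V by simp
  have \<phi>_nonconst: "\<phi> - \<kappa> c \<notin> M" for c
  proof -
    have "local_exp v (U - const3 c * V) \<noteq> 0"
    proof
      assume "local_exp v (U - const3 c * V) = 0"
      then have "S2 - const2 c * T2 = 0"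
        by (simp only: local_exp.hom_diff local_exp.hom_mult local_exp_const3 frame)
      then have "coef2 (S2 - const2 c * T2) 1 0 = 0" by (simp only: coeff_0)
      then show False by simp
    qed
    then have "U - const3 c * V \<noteq> 0"
      by (auto simp only: local_exp.hom_zero)
    moreover have homog: "homogeneous 1 (U - const3 c * V)"
      using hom by (intro homogeneous_diff homogeneous_const3_mult)
    ultimately have "\<not> F dvd U - const3 c * V"
      using F_not_dvd d by auto
    moreover have "\<phi> - \<kappa> c = Fract (U - const3 c * V) V"
      using V0 by (simp add: \<phi>_def \<kappa>_def)
    ultimately show ?thesis
      using Fract_in_M_iff[OF homog hom(2) V] by simp
  qed
  have ut: "\<iota> U / \<iota> W = \<phi> * t" and vt: "\<iota> V / \<iota> W = t"
    using V0 W0 by (simp_all add: \<iota>_def \<phi>_def t_def eq_fract)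
  have taylor: "subst2 \<kappa> (local_exp v G) (\<phi> * t) t = Fract G (W ^ n)" if "homogeneous n G" for n G
    using subst2_local_exp[OF frame W0 that] unfolding ut vt
    by (simp add: \<iota>_def flip: \<iota>.hom_power[unfolded \<iota>_def])

  define c where "c k = (\<Sum>i\<le>k. monom (coef2 (local_exp v F) i (k - i)) i)" for k
  have coeff_c: "coeff (c k) i = (if i \<le> k then coef2 (local_exp v F) i (k - i) else 0)" for k i
    by (simp add: c_def coeff_sum coeff_monom sum.delta)
  have c_low: "c k = 0" if "k < m" for k
    by (rule poly_eqI) (use ord that in \<open>auto simp: coeff_c order_ge_def\<close>)
  have F_expand: "Fract F (W ^ d) = (\<Sum>k<Suc d. poly (map_poly \<kappa> (c k)) \<phi> * t ^ k)"
    unfolding c_def taylor[OF homogeneous_F, symmetric]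
    by (rule subst2_expand) (rule local_exp_degree_le[OF homogeneous_F])
  have FM: "Fract F (W ^ d) \<in> M"
    using Fract_in_M_iff[OF homogeneous_F] homogeneous_power[OF hom(3), of d] F_not_dvd_power[OF W]
    by simp
  \<comment> \<open>The polynomial for \<open>t\<close> ends at the last nonzero coefficient, since a polynomial over a field is
    required to have a nonzero leading coefficient.\<close>
  have "\<exists>k\<le>d. c k \<noteq> 0"
  proof (rule ccontr)
    assume "\<not> ?thesis"
    then have "Fract F (W ^ d) = 0"
      unfolding F_expand by (intro sum.neutral) auto
    then show False
      using W0 F_nonzero by (simp add: Zero_fract_def eq_fract)
  qed
  then obtain k0 where "k0 \<le> d" "c k0 \<noteq> 0" by blast
  define D where "D = (GREATEST k. k \<le> d \<and> c k \<noteq> 0)"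
  have D: "D \<le> d" "c D \<noteq> 0"
    unfolding D_def using GreatestI_nat[of "\<lambda>k. k \<le> d \<and> c k \<noteq> 0" k0 d] \<open>k0 \<le> d\<close> \<open>c k0 \<noteq> 0\<close> by auto
  have c_high: "c k = 0" if "D < k" "k \<le> d" for k
    using Greatest_le_nat[of "\<lambda>k. k \<le> d \<and> c k \<noteq> 0" k d] that unfolding D_def by force
  have mD: "m \<le> D"
    using c_low D(2) not_less by blast
  define g where "g j = poly (map_poly \<kappa> (c (m + j))) \<phi>" for j
  have gR: "g j \<in> carrier R" for j
    unfolding g_def by (rule R_poly[OF \<phi>R])
  define r where "r = D - m"
  have relation: "(\<Sum>j<Suc r. g j * t ^ j) \<in> M"
  proof -
    have "Fract F (W ^ d) = (\<Sum>k\<in>{m..D}. poly (map_poly \<kappa> (c k)) \<phi> * t ^ k)"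
      unfolding F_expand
    proof (rule sum.mono_neutral_right)
      show "\<forall>k\<in>{..<Suc d} - {m..D}. poly (map_poly \<kappa> (c k)) \<phi> * t ^ k = 0"
        using c_low c_high by (auto simp: not_le)
    qed (use D in auto)
    also have "\<dots> = (\<Sum>j<Suc r. poly (map_poly \<kappa> (c (m + j))) \<phi> * t ^ (m + j))"
      by (rule sum.reindex_bij_witness[of _ "\<lambda>j. m + j" "\<lambda>k. k - m"])
        (use mD in \<open>auto simp: r_def\<close>)
    also have "\<dots> = t ^ m * (\<Sum>j<Suc r. g j * t ^ j)"
      unfolding sum_distrib_left by (rule sum.cong) (simp_all add: g_def power_add mult_ac)
    finally have "t ^ m * (\<Sum>j<Suc r. g j * t ^ j) \<in> M"
      using FM by simp
    moreover have "t ^ m \<notin> M"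
    proof (induction m)
      case (Suc m)
      then show ?case using M_prime[OF tR R_power[OF tR]] tM by auto
    qed (simp add: one_notin_M)
    ultimately show ?thesis
      using M_prime R_power[OF tR] R_sum R_mult gR by (metis (no_types, lifting))
  qed

  define E where "E = generate_field K (insert (\<pi> \<phi>) (function_field_constants F))"
  have gens: "insert (\<pi> \<phi>) (function_field_constants F) \<subseteq> carrier K"
    using \<pi>_carrier \<phi>R R_const by (auto simp: function_field_constants_eq)
  have E: "subfield E K"
    unfolding E_def by (rule K.generate_field_is_subfield[OF gens])
  have Esub: "subring E K"
    using E by (rule subfieldE(1))
  have E_const: "\<pi> (\<kappa> a) \<in> E" for a
    unfolding E_def by (rule generate_field.incl) (auto simp: function_field_constants_eq)
  have E\<phi>: "\<pi> \<phi> \<in> E"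
    unfolding E_def by (rule generate_field.incl) simp
  have E_poly: "\<pi> (poly (map_poly \<kappa> p) \<phi>) \<in> E" for p
  proof -
    have "poly (map_poly \<kappa> p) \<phi> \<in> {x \<in> carrier R. \<pi> x \<in> E}"
      by (rule poly_map_poly_closed)
        (use E_const E\<phi> \<phi>R R_const subringE(2,6,7)[OF Esub] in
          \<open>auto simp: \<kappa>.hom_zero R_zero R_add R_mult \<pi>_add \<pi>_mult \<pi>_zero\<close>)
    then show ?thesis by simp
  qed
  define q where "q = map (\<lambda>j. \<pi> (g j)) (rev [0..<Suc r])"
  have "polynomial\<^bsub>K\<^esub> E q"
  proof -
    have "set q \<subseteq> E"
      using E_poly by (auto simp: q_def g_def)
    moreover have "hd q \<noteq> \<zero>\<^bsub>K\<^esub>"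
    proof -
      have "g r = poly (map_poly \<kappa> (c D)) \<phi>"
        by (simp add: g_def r_def mD)
      then have "g r \<notin> M"
        using nonconstant_is_transcendental[OF \<phi>R \<phi>_nonconst D(2)] by simp
      then show ?thesis
        using \<pi>_eq_zero_iff[OF gR] by (simp add: q_def)
    qed
    ultimately show ?thesis by (simp add: polynomial_def)
  qed
  then have qE: "q \<in> carrier (E [X]\<^bsub>K\<^esub>)"
    by (simp add: univ_poly_def)
  have q_ne: "q \<noteq> []" and q_deg: "length q - 1 = r"
    by (simp_all add: q_def)
  have q_root: "K.eval q (\<pi> t) = \<zero>\<^bsub>K\<^esub>"
    unfolding q_def eval_image[OF tR gR]
    using relation \<pi>_eq_zero_iff M_subset by blast
  have tK: "\<pi> t \<in> carrier K"
    by (rule \<pi>_carrier[OF tR])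
  have alg: "\<not> ring.transcendental K E (\<pi> t)"
    using K.algebraicI[OF qE q_ne q_root] by (simp add: over_def)
  define L where "L = K.simple_extension E (\<pi> t)"
  have L: "subfield L K"
    unfolding L_def using K.simple_extension_is_subfield[OF E tK] alg by (simp add: over_def)
  have Lsub: "subring L K"
    using L by (rule subfieldE(1))
  have EL: "E \<subseteq> L"
    unfolding L_def by (rule K.simple_extension_incl[OF subfieldE(3)[OF E] tK])
  have Lt: "\<pi> t \<in> L"
    unfolding L_def by (rule K.simple_extension_mem[OF Esub tK])
  \<comment> \<open>Every form becomes a polynomial in \<open>\<phi> * t\<close> and \<open>t\<close> after division by a power of \<open>W\<close>; quotients
    of forms are then covered because \<open>L\<close> is a field.\<close>
  have L_expand: "Fract G (W ^ n) \<in> carrier R \<and> \<pi> (Fract G (W ^ n)) \<in> L" if "homogeneous n G" for G n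
  proof -
    let ?C = "{x \<in> carrier R. \<pi> x \<in> L}"
    have add: "a + b \<in> ?C" and mult: "a * b \<in> ?C" if "a \<in> ?C" "b \<in> ?C" for a b
      using that subringE(6,7)[OF Lsub] by (auto simp: R_add R_mult \<pi>_add \<pi>_mult)
    have zero: "0 \<in> ?C"
      using subringE(2)[OF Lsub] by (simp add: R_zero \<pi>_zero)
    have t: "t \<in> ?C" and \<phi>t: "\<phi> * t \<in> ?C"
      using tR Lt \<phi>R E\<phi> EL mult[of \<phi> t] by auto
    have "subst2 \<kappa> (local_exp v G) (\<phi> * t) t \<in> ?C"
      unfolding subst2_def
    proof (rule poly_map_poly_closed[where C = ?C, OF _ _ t zero add mult])
      show "poly (map_poly \<kappa> e) (\<phi> * t) \<in> ?C" for e
        by (rule poly_map_poly_closed[where C = ?C and h = \<kappa>, OF \<kappa>.hom_zero _ \<phi>t zero add mult])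
          (use R_const E_const EL in auto)
    qed simp_all
    then show ?thesis
      unfolding taylor[OF that] by simp
  qed
  have "L = carrier K"
  proof
    show "L \<subseteq> carrier K" by (rule subfieldE(3)[OF L])
    show "carrier K \<subseteq> L"
    proof
      fix x
      assume "x \<in> carrier K"
      then obtain y where y: "y \<in> carrier R" "x = \<pi> y"
        by (auto simp: carrier_K)
      obtain G H n where GH: "y = Fract G H" "homogeneous n G" "homogeneous n H" "\<not> F dvd H" "H \<noteq> 0"
        using y(1) by (rule carrier_R_E)
      let ?h = "Fract H (W ^ n)"
      have Wn: "homogeneous n (W ^ n)" "\<not> F dvd W ^ n"
        using homogeneous_power[OF hom(3), of n] F_not_dvd_power[OF W] by auto
      have "y * ?h = Fract G (W ^ n)"
        using GH(5) W0 by (simp add: GH(1) eq_fract)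
      then have eq: "\<pi> y \<otimes>\<^bsub>K\<^esub> \<pi> ?h = \<pi> (Fract G (W ^ n))"
        using \<pi>_mult[OF y(1)] L_expand[OF GH(3)] by metis
      have h0: "\<pi> ?h \<noteq> \<zero>\<^bsub>K\<^esub>"
        using \<pi>_eq_zero_iff L_expand[OF GH(3)] Fract_in_M_iff[OF GH(3) Wn] GH(4) by simp
      have hL: "\<pi> ?h \<in> L" and hK: "\<pi> ?h \<in> carrier K"
        using L_expand[OF GH(3)] \<pi>_carrier by auto
      have inv: "inv\<^bsub>K\<^esub> \<pi> ?h \<in> L"
        using K.subfield_m_inv(1)[OF L] hL h0 by blast
      have hU: "\<pi> ?h \<in> Units K"
        using hK h0 by (simp add: K.field_Units)
      have "\<pi> y = (\<pi> y \<otimes>\<^bsub>K\<^esub> \<pi> ?h) \<otimes>\<^bsub>K\<^esub> inv\<^bsub>K\<^esub> \<pi> ?h"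
        using \<pi>_carrier[OF y(1)] hK hU by (simp add: K.m_assoc)
      also have "\<dots> \<in> L"
        unfolding eq using L_expand[OF GH(2)] inv subringE(6)[OF Lsub] by blast
      finally show "x \<in> L" by (simp add: y(2))
    qed
  qed
  then have dim: "ring.dimension K (length (K.Irr E (\<pi> t)) - 1) E (carrier K)"
    using K.dimension_simple_extension[OF E tK] alg by (simp add: L_def over_def)
  have deg: "length (K.Irr E (\<pi> t)) - 1 \<le> r"
  proof -
    have alg': "(K.algebraic over E) (\<pi> t)"
      using alg by (simp add: over_def)
    show ?thesis
      using K.pdivides_imp_degree_le[OF Esub K.IrrE(1)[OF E tK alg'] qE q_ne
          K.Irr_minimal[OF E tK alg' qE q_root]]
      by (simp only: q_deg)
  qed
  have "gonality F \<le> length (K.Irr E (\<pi> t)) - 1"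
    unfolding gonality_def
  proof (rule Least_le, rule bexI)
    show "map_has_degree F (\<pi> \<phi>) (length (K.Irr E (\<pi> t)) - 1)"
      using dim by (simp add: map_has_degree_def E_def)
    show "\<pi> \<phi> \<in> carrier K - function_field_constants F"
    proof
      show "\<pi> \<phi> \<in> carrier K" by (rule \<pi>_carrier[OF \<phi>R])
      show "\<pi> \<phi> \<notin> function_field_constants F"
      proof
        assume "\<pi> \<phi> \<in> function_field_constants F"
        then obtain a where a: "\<pi> \<phi> = \<pi> (\<kappa> a)"
          by (auto simp: function_field_constants_eq)
        have "\<pi> (\<phi> - \<kappa> a) = \<pi> \<phi> \<oplus>\<^bsub>K\<^esub> \<pi> (\<kappa> (- a))"
          using \<pi>_add[OF \<phi>R R_const[of "- a"]] by (simp add: \<kappa>.hom_uminus)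
        also have "\<dots> = \<pi> (\<kappa> a + \<kappa> (- a))"
          by (simp only: a \<pi>_add[OF R_const R_const])
        also have "\<dots> = \<zero>\<^bsub>K\<^esub>"
          by (simp add: \<kappa>.hom_uminus \<pi>_zero)
        finally have "\<phi> - \<kappa> a \<in> M"
          using \<pi>_eq_zero_iff[of "\<phi> - \<kappa> a"] R_add[OF \<phi>R R_uminus[OF R_const[of a]]] by simp
        then show False using \<phi>_nonconst by blast
      qed
    qed
  qed
  then show ?thesis
    using deg D(1) mD by (simp add: r_def)
qed

end

section \<open>The inequality\<close>

lemma projective_point_representative:
  assumes "q \<in> projective_plane"
  obtains v where "v \<noteq> 0" "v \<in> q" "q = {w. w \<noteq> 0 \<and> (\<exists>t. w = t *s v)}"
proof -
  obtain v where v: "v \<noteq> 0" "q = {w. w \<noteq> 0 \<and> (\<exists>t. w = t *s v)}"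
    using assms by (auto simp: projective_plane_def quotient_def)
  moreover have "v \<in> q"
    using v by (auto intro: exI[of _ 1])
  ultimately show thesis
    using that by blast
qed

lemma projective_points_distinct:
  assumes q: "q \<in> projective_plane" "q' \<in> projective_plane"
    and v: "v \<in> q" "w \<in> q'" "v = t *s w"
  shows "q = q'"
proof -
  obtain a where a: "q = {w. w \<noteq> 0 \<and> (\<exists>t. w = t *s a)}"
    using q(1) by (rule projective_point_representative)
  obtain b where b: "q' = {w. w \<noteq> 0 \<and> (\<exists>t. w = t *s b)}"
    using q(2) by (rule projective_point_representative)
  obtain x y where x: "v = x *s a" "v \<noteq> 0" and y: "w = y *s b"
    using v a b by blast
  have "x \<noteq> 0" and ty: "t * y \<noteq> 0"
    using x y v(3) by auto
  have "x *s a = (t * y) *s b"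
    using x(1) y v(3) by simp
  then have "(1 / x) *s (x *s a) = (1 / x) *s ((t * y) *s b)" "(1 / (t * y)) *s (x *s a) = (1 / (t * y)) *s ((t * y) *s b)"
    by simp_all
  then have ab: "a = (t * y / x) *s b" "b = (x / (t * y)) *s a"
    using \<open>x \<noteq> 0\<close> ty by (simp_all add: vector_smult_assoc del: divide_eq_eq eq_divide_eq)
  show ?thesis
  proof (intro equalityI subsetI)
    fix z
    assume "z \<in> q"
    then obtain c where "z = c *s a" "z \<noteq> 0" using a by blast
    then show "z \<in> q'"
      unfolding b using ab(1) by (auto simp: vector_smult_assoc)
  next
    fix z
    assume "z \<in> q'"
    then obtain c where "z = c *s b" "z \<noteq> 0" using b by blast
    then show "z \<in> q"
      unfolding a using ab(2) by (auto simp: vector_smult_assoc)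
  qed
qed

theorem lemma2p7:
  fixes F :: poly3 and d s :: nat
    and p :: "nat \<Rightarrow> (complex ^ 3) set" and m :: "nat \<Rightarrow> nat"
    and pt :: "(complex ^ 3) set"
  assumes "integral_plane_curve d F" and "d \<ge> 3"
    and "bij_betw p {1..s} (Sing F)" and "s \<ge> 3"
    and "\<And>i. i \<in> {1..s} \<Longrightarrow> m i = curve_mult F (p i)"
    and "\<And>i. i \<in> {1..s} \<Longrightarrow> m i \<ge> 2"
    and "\<And>i j. 1 \<le> i \<Longrightarrow> i \<le> j \<Longrightarrow> j \<le> s \<Longrightarrow> m j \<le> m i"
    and "pt \<in> Sing F"
  shows "(int d)\<^sup>2 \<ge> int (curve_mult F pt) + (\<Sum>i=1..s. (int (m i) - 1)\<^sup>2)
           + 2 * (int (gonality F) - 1)"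
proof -
  have plane: "q \<in> projective_plane" if "q \<in> Sing F" for q
    using that by (simp add: Sing_def)
  have "\<exists>v. v \<in> q \<and> v \<noteq> 0" if "q \<in> Sing F" for q
    using projective_point_representative[OF plane[OF that]] by metis
  then obtain rep where rep: "\<And>q. q \<in> Sing F \<Longrightarrow> rep q \<in> q" "\<And>q. q \<in> Sing F \<Longrightarrow> rep q \<noteq> 0"
    by metis
  have p_Sing: "p i \<in> Sing F" if "i \<in> {1..s}" for i
    using assms(3) that by (auto simp: bij_betw_def)
  define f where "f i = rep (p i)" for i
  have f_eq: "i = j" if "i \<in> {1..s}" "j \<in> {1..s}" "f i = t *s f j" for i j t
  proof -
    have "p i = p j"
      using that(3) unfolding f_def
      by (rule projective_points_distinct[OF plane plane rep(1) rep(1), OF p_Sing p_Sing p_Sing p_Sing,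
            OF that(1) that(2) that(1) that(2)])
    then show ?thesis
      by (rule inj_onD[OF bij_betw_imp_inj_on[OF assms(3)] _ that(1,2)])
  qed
  have inj: "inj_on f {1..s}"
  proof (rule inj_onI)
    fix i j
    assume "i \<in> {1..s}" "j \<in> {1..s}" "f i = f j"
    then show "i = j"
      by (intro f_eq[of i j 1]) simp_all
  qed
  define M where "M v = m (inv_into {1..s} f v)" for v
  have Mf: "M (f i) = m i" if "i \<in> {1..s}" for i
    using inv_into_f_f[OF inj that] by (simp add: M_def)
  have "(\<Sum>v\<in>f ` {1..s}. (M v - 1)\<^sup>2) \<le> (d - 1)\<^sup>2"
  proof (rule polar_inequality[OF assms(1)])
    show "2 \<le> d" using assms(2) by simp
    show "0 \<notin> f ` {1..s}"
      using rep(2)[OF p_Sing] by (auto simp: f_def)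
    show "v = w" if "v \<in> f ` {1..s}" "w \<in> f ` {1..s}" "v = t *s w" for v w t
      using that f_eq by blast
    show "vanishes_to_order (M v) v F" if v: "v \<in> f ` {1..s}" for v
    proof -
      obtain i where i: "i \<in> {1..s}" "v = f i"
        using v by blast
      then show ?thesis
        using vanishes_to_order_curve_mult[OF rep(1)[OF p_Sing[OF i(1)]]] assms(5)[OF i(1)] Mf[OF i(1)]
        by (simp add: f_def)
    qed
  qed simp
  also have "(\<Sum>v\<in>f ` {1..s}. (M v - 1)\<^sup>2) = (\<Sum>i=1..s. (m i - 1)\<^sup>2)"
    unfolding sum.reindex[OF inj] by (intro sum.cong refl) (simp only: o_apply Mf)
  finally have bezout: "int (\<Sum>i=1..s. (m i - 1)\<^sup>2) \<le> int ((d - 1)\<^sup>2)"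
    by (simp only: of_nat_le_iff)
  have sum: "int (\<Sum>i=1..s. (m i - 1)\<^sup>2) = (\<Sum>i=1..s. (int (m i) - 1)\<^sup>2)"
    unfolding of_nat_sum
  proof (rule sum.cong[OF refl])
    fix i
    assume "i \<in> {1..s}"
    then have "1 \<le> m i"
      using assms(6)[of i] by simp
    then show "int ((m i - 1)\<^sup>2) = (int (m i) - 1)\<^sup>2"
      by (simp add: of_nat_diff)
  qed
  have square: "int ((d - 1)\<^sup>2) = (int d)\<^sup>2 - 2 * int d + 1"
  proof -
    have pred: "int (d - 1) = int d - 1"
      using assms(2) by simp
    show ?thesis
      unfolding of_nat_power pred by (simp add: power2_eq_square algebra_simps)
  qed
  have "gonality F + curve_mult F pt \<le> d"
  proof -
    interpret integral_curve F d
      by standard (rule assms(1))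
    show ?thesis
      using assms(2) rep[OF assms(8)] vanishes_to_order_curve_mult
      by (intro gonality_projection[of "rep pt"] vanishes_to_order_local_exp) auto
  qed
  then have "int (gonality F) + int (curve_mult F pt) \<le> int d"
    by (simp flip: of_nat_add)
  moreover have "\<mu> + \<Sigma> + 2 * (g - 1) \<le> e"
    if "g + \<mu> \<le> \<delta>" "\<Sigma> \<le> e - 2 * \<delta> + 1" "0 \<le> \<mu>" for g \<mu> \<Sigma> e \<delta> :: int
    using that by presburger
  ultimately show ?thesis
    using bezout unfolding sum square by simp
qed

end
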